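(* Let $\mathcal{A}$ be a unital $C^*$-algebra, $\mathcal{B}$ a unital $C^*$-algebra, $\Phi:\mathcal{A}\to\mathcal{B}$ a tracial positive linear map, and $\rho\in\mathcal{A}$ self-adjoint. Let $f,g$ be continuous positive real-valued functions on (an interval containing) the spectrum of $\rho$ such that $f(\rho)g(\rho)>0$ and $\Phi(f(\rho)g(\rho))$ is invertible. Then for every $A\in\mathcal{A}$, \begin{align*} \tfrac12\big(\Phi(f(\rho)A^*g(\rho)A)+\Phi(f(\rho)Ag(\rho)A^* )\big) &\ge \Phi\big(f(\rho)^{1/2}g(\rho)^{1/2}A^*f(\rho)^{1/2}g(\rho)^{1/2}A\big)\\ &\ge \Phi(f(\rho)A^*g(\rho))\,\Phi(f(\rho)g(\rho))^{-1}\,\Phi(g(\rho)Af(\rho)). \end{align*} In particular, for every self-adjoint $A\in\mathcal{A}$, \[ \mathrm{I}_{\rho,\Phi}^{f,g}(A)\ \le\ \mathrm{I}_{\rho,\Phi}^{\sqrt{fg},\sqrt{fg}}(A)\ \le\ \mathrm{Var}_{\rho,\Phi}^{fg,1}(A). \]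
   Context: A linear map $\Phi$ is tracial if $\Phi(XY)=\Phi(YX)$ for all $X,Y$ in its domain, and positive if it maps positive elements to positive elements. $Y>0$ means positive and invertible. For functions $F,G$ on the spectrum of $\rho$: $\mathrm{Corr}_{\rho,\Phi}^{F,G}(A,B):=\Phi(F(\rho)G(\rho)A^*B)-\Phi(F(\rho)A^*G(\rho)B)$, $\mathrm{I}_{\rho,\Phi}^{F,G}(A):=\mathrm{Corr}_{\rho,\Phi}^{F,G}(A,A)$; for $F$ positive and $\Phi(F(\rho)G(\rho)^2)>0$: $\mathrm{Cov}_{\rho,\Phi}^{F,G}(A,B):=\Phi(F(\rho)A^*B)-\Phi(F(\rho)G(\rho)A^* )\Phi(F(\rho)G(\rho)^2)^{-1}\Phi(F(\rho)G(\rho)B)$ and $\mathrm{Var}_{\rho,\Phi}^{F,G}(A):=\mathrm{Cov}_{\rho,\Phi}^{F,G}(A,A)$. Here $fg$ and $\sqrt{fg}$ denote pointwise product and pointwise square root, and $1$ the constant function. *)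

theory Defs
  imports "HOL-Analysis.Analysis" "HOL-Computational_Algebra.Polynomial"
begin

class cstar_algebra = real_normed_algebra_1 + banach +
  fixes adj :: "'a \<Rightarrow> 'a"
    and scaleC :: "complex \<Rightarrow> 'a \<Rightarrow> 'a"
  assumes scaleC_scaleR: "scaleC (complex_of_real r) x = scaleR r x"
    and scaleC_add_left: "scaleC (a + b) x = scaleC a x + scaleC b x"
    and scaleC_add_right: "scaleC a (x + y) = scaleC a x + scaleC a y"
    and scaleC_scaleC: "scaleC a (scaleC b x) = scaleC (a * b) x"
    and norm_scaleC: "norm (scaleC a x) = cmod a * norm x"
    and mult_scaleC_left: "scaleC a x * y = scaleC a (x * y)"
    and mult_scaleC_right: "x * scaleC a y = scaleC a (x * y)"
    and adj_adj: "adj (adj x) = x"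
    and adj_add: "adj (x + y) = adj x + adj y"
    and adj_scaleC: "adj (scaleC a x) = scaleC (cnj a) (adj x)"
    and adj_mult: "adj (x * y) = adj y * adj x"
    and cstar_identity: "norm (adj x * x) = (norm x)\<^sup>2"

definition cinvertible :: "'a::cstar_algebra \<Rightarrow> bool" where
  "cinvertible x \<longleftrightarrow> (\<exists>y. x * y = 1 \<and> y * x = 1)"

definition cinv :: "'a::cstar_algebra \<Rightarrow> 'a" where
  "cinv x = (SOME y. x * y = 1 \<and> y * x = 1)"

definition cspectrum :: "'a::cstar_algebra \<Rightarrow> complex set" where
  "cspectrum x = {c. \<not> cinvertible (x - scaleC c 1)}"

definition real_spectrum :: "'a::cstar_algebra \<Rightarrow> real set" where
  "real_spectrum x = {t. complex_of_real t \<in> cspectrum x}"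

definition selfadjoint :: "'a::cstar_algebra \<Rightarrow> bool" where
  "selfadjoint x \<longleftrightarrow> adj x = x"

definition cpositive :: "'a::cstar_algebra \<Rightarrow> bool" where
  "cpositive x \<longleftrightarrow> selfadjoint x \<and> cspectrum x \<subseteq> complex_of_real ` {0..}"

definition cstrictly_positive :: "'a::cstar_algebra \<Rightarrow> bool" where
  "cstrictly_positive x \<longleftrightarrow> cpositive x \<and> cinvertible x"

definition cle :: "'a::cstar_algebra \<Rightarrow> 'a \<Rightarrow> bool" where
  "cle x y \<longleftrightarrow> cpositive (y - x)"

definition polyeval :: "real poly \<Rightarrow> 'a::cstar_algebra \<Rightarrow> 'a" where
  "polyeval p x = (\<Sum>i\<le>degree p. coeff p i *\<^sub>R x ^ i)"

definition cfc :: "(real \<Rightarrow> real) \<Rightarrow> 'a::cstar_algebra \<Rightarrow> 'a" where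
  "cfc f \<rho> = (THE b. \<forall>ps :: nat \<Rightarrow> real poly.
      uniform_limit (real_spectrum \<rho>) (\<lambda>n t. poly (ps n) t) f sequentially
        \<longrightarrow> (\<lambda>n. polyeval (ps n) \<rho>) \<longlonglongrightarrow> b)"

definition clinear_map :: "('a::cstar_algebra \<Rightarrow> 'b::cstar_algebra) \<Rightarrow> bool" where
  "clinear_map \<Phi> \<longleftrightarrow> (\<forall>x y. \<Phi> (x + y) = \<Phi> x + \<Phi> y) \<and> (\<forall>c x. \<Phi> (scaleC c x) = scaleC c (\<Phi> x))"

definition positive_map :: "('a::cstar_algebra \<Rightarrow> 'b::cstar_algebra) \<Rightarrow> bool" where
  "positive_map \<Phi> \<longleftrightarrow> (\<forall>x. cpositive x \<longrightarrow> cpositive (\<Phi> x))"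

definition tracial :: "('a::cstar_algebra \<Rightarrow> 'b::cstar_algebra) \<Rightarrow> bool" where
  "tracial \<Phi> \<longleftrightarrow> (\<forall>x y. \<Phi> (x * y) = \<Phi> (y * x))"

definition Corr :: "'a::cstar_algebra \<Rightarrow> ('a \<Rightarrow> 'b::cstar_algebra) \<Rightarrow> (real \<Rightarrow> real) \<Rightarrow> (real \<Rightarrow> real) \<Rightarrow> 'a \<Rightarrow> 'a \<Rightarrow> 'b" where
  "Corr \<rho> \<Phi> F G A B = \<Phi> (cfc F \<rho> * cfc G \<rho> * adj A * B) - \<Phi> (cfc F \<rho> * adj A * cfc G \<rho> * B)"

definition Info :: "'a::cstar_algebra \<Rightarrow> ('a \<Rightarrow> 'b::cstar_algebra) \<Rightarrow> (real \<Rightarrow> real) \<Rightarrow> (real \<Rightarrow> real) \<Rightarrow> 'a \<Rightarrow> 'b" where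
  "Info \<rho> \<Phi> F G A = Corr \<rho> \<Phi> F G A A"

definition Cov :: "'a::cstar_algebra \<Rightarrow> ('a \<Rightarrow> 'b::cstar_algebra) \<Rightarrow> (real \<Rightarrow> real) \<Rightarrow> (real \<Rightarrow> real) \<Rightarrow> 'a \<Rightarrow> 'a \<Rightarrow> 'b" where
  "Cov \<rho> \<Phi> F G A B = \<Phi> (cfc F \<rho> * adj A * B)
     - \<Phi> (cfc F \<rho> * cfc G \<rho> * adj A) * cinv (\<Phi> (cfc F \<rho> * (cfc G \<rho>)\<^sup>2)) * \<Phi> (cfc F \<rho> * cfc G \<rho> * B)"

definition Var :: "'a::cstar_algebra \<Rightarrow> ('a \<Rightarrow> 'b::cstar_algebra) \<Rightarrow> (real \<Rightarrow> real) \<Rightarrow> (real \<Rightarrow> real) \<Rightarrow> 'a \<Rightarrow> 'b" where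
  "Var \<rho> \<Phi> F G A = Cov \<rho> \<Phi> F G A A"

end

theory Submission
  imports Defs "HOL-Computational_Algebra.Fundamental_Theorem_Algebra"
begin

text \<open>Both inequalities are consequences of traciality and positivity. For the first, expand
  \<open>\<Phi> (z\<^sup>* z) \<ge> 0\<close> for \<open>z = g\<^sup>\<onehalf> A f\<^sup>\<onehalf> - f\<^sup>\<onehalf> A g\<^sup>\<onehalf>\<close> and move factors cyclically. The second
  is the Schwarz inequality \<open>\<Phi> (X\<^sup>* X) \<ge> \<Phi> (X\<^sup>* c) \<Phi> (c\<^sup>2)\<inverse> \<Phi> (c X)\<close> for
  \<open>c = (f g)\<^sup>\<onehalf>\<close> and \<open>X = c\<^sup>\<onehalf> A c\<^sup>\<onehalf>\<close>. It expresses a 2-positivity of \<open>\<Phi>\<close>, for which the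
  classical argument factors \<open>\<Phi>\<close> through a commutative algebra (Choi and Tsui). Here it is
  obtained by writing \<open>X = h + \<i>k\<close> and discretising the spectra of \<open>h\<close>, \<open>c\<close>, \<open>k\<close>: with resolutions
  of unity \<open>\<Sum> p\<^sub>i\<^sup>2\<close>, \<open>\<Sum> q\<^sub>j\<^sup>2\<close>, \<open>\<Sum> s\<^sub>l\<^sup>2\<close>, the elements
  \<open>r\<^sub>i\<^sub>j\<^sub>l = \<Phi> (p\<^sub>i\<^sup>2 q\<^sub>j s\<^sub>l\<^sup>2 q\<^sub>j)\<close> are positive, and the inequality is the positivity of
  \<open>\<Sum> w\<^sub>i\<^sub>j\<^sub>l\<^sup>* r\<^sub>i\<^sub>j\<^sub>l w\<^sub>i\<^sub>j\<^sub>l\<close> for suitable \<open>w\<^sub>i\<^sub>j\<^sub>l\<close>, up to an error that vanishes in the limit.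

  The spectral theory needed is elementary: that a self-adjoint \<open>x\<close> of norm 1 has \<open>1\<close> or \<open>-1\<close> in
  its spectrum follows without Gelfand theory or complex analysis, since otherwise the partial sums
  \<open>(1 - x\<^sup>2\<^sup>n) (1 - x\<^sup>2)\<inverse>\<close> of \<open>\<Sum> x\<^sup>2\<^sup>m\<close> would stay bounded, whereas their norm is at
  least \<open>n\<close>.\<close>

subsection \<open>Involution and scalars\<close>

lemma scaleC_zero_left [simp]: "scaleC 0 (x::'a::cstar_algebra) = 0"
  using scaleC_scaleR[of 0 x] by simp

lemma scaleC_one [simp]: "scaleC 1 (x::'a::cstar_algebra) = x"
  using scaleC_scaleR[of 1 x] by simp

lemma scaleC_minus_left [simp]: "scaleC (- a) (x::'a::cstar_algebra) = - scaleC a x"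
  using scaleC_add_left[of a "- a" x] by (simp add: eq_neg_iff_add_eq_0 add.commute)

lemma adj_zero [simp]: "adj (0::'a::cstar_algebra) = 0"
  using adj_scaleC[of 0 "0::'a"] by simp

lemma adj_scaleR: "adj (r *\<^sub>R (x::'a::cstar_algebra)) = r *\<^sub>R adj x"
  using adj_scaleC[of "complex_of_real r" x] by (simp add: scaleC_scaleR)

lemma adj_minus: "adj (- (x::'a::cstar_algebra)) = - adj x"
  using adj_scaleR[of "-1" x] by simp

lemma adj_diff: "adj ((x::'a::cstar_algebra) - y) = adj x - adj y"
  using adj_add[of x "- y"] by (simp add: adj_minus)

lemma adj_one [simp]: "adj (1::'a::cstar_algebra) = 1"
  by (metis adj_adj adj_mult mult.left_neutral)

lemma selfadjointD: "selfadjoint x \<Longrightarrow> adj x = x"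
  by (simp add: selfadjoint_def)

lemma selfadjoint_zero [simp]: "selfadjoint 0"
  and selfadjoint_one [simp]: "selfadjoint 1"
  and selfadjoint_add: "selfadjoint x \<Longrightarrow> selfadjoint y \<Longrightarrow> selfadjoint (x + y)"
  and selfadjoint_diff: "selfadjoint x \<Longrightarrow> selfadjoint y \<Longrightarrow> selfadjoint (x - y)"
  and selfadjoint_scaleR: "selfadjoint x \<Longrightarrow> selfadjoint (r *\<^sub>R x)"
  and selfadjoint_mult: "selfadjoint x \<Longrightarrow> selfadjoint y \<Longrightarrow> x * y = y * x \<Longrightarrow> selfadjoint (x * y)"
  and selfadjoint_adj_mult: "selfadjoint (adj z * z)"
  by (simp_all add: selfadjoint_def adj_add adj_diff adj_minus adj_scaleR adj_mult adj_adj)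

lemma selfadjoint_sum: "(\<And>i. i \<in> A \<Longrightarrow> selfadjoint (h i)) \<Longrightarrow> selfadjoint (sum h A)"
  by (induction A rule: infinite_finite_induct) (simp_all add: selfadjoint_add)

lemma selfadjoint_power: "selfadjoint (x::'a::cstar_algebra) \<Longrightarrow> selfadjoint (x ^ n)"
  by (induction n) (simp_all add: selfadjoint_mult power_commutes)

section \<open>Norm and involution\<close>

lemma norm_adj: "norm (adj (x::'a::cstar_algebra)) = norm x"
proof -
  have le: "norm y \<le> norm (adj y)" for y :: 'a
  proof (cases "y = 0")
    case False
    have "norm y * norm y \<le> norm (adj y) * norm y"
      using cstar_identity[of y] norm_mult_ineq[of "adj y" y] by (simp add: power2_eq_square)
    then show ?thesis using False by simp
  qed simp
  from le[of x] le[of "adj x"] show ?thesis by (simp add: adj_adj)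
qed

lemma tendsto_adj:
  assumes "(h \<longlongrightarrow> (b::'a::cstar_algebra)) F" shows "((\<lambda>n. adj (h n)) \<longlongrightarrow> adj b) F"
  using assms by (simp add: tendsto_iff dist_norm norm_adj flip: adj_diff)

lemma norm_mult_self: "selfadjoint (x::'a::cstar_algebra) \<Longrightarrow> norm (x * x) = (norm x)\<^sup>2"
  by (metis cstar_identity selfadjointD)

text \<open>The C*-identity controls squares of self-adjoint elements; iterating it reaches the
  exponents \<open>2 ^ k\<close>.\<close>

lemma norm_power_two_power:
  assumes "selfadjoint (x::'a::cstar_algebra)" shows "norm (x ^ (2 ^ k)) = norm x ^ (2 ^ k)"
proof (induction k)
  case (Suc k)
  have "x ^ (2 ^ Suc k) = x ^ (2 ^ k) * x ^ (2 ^ k)" by (simp add: mult_2 flip: power_add)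
  then have "norm (x ^ (2 ^ Suc k)) = (norm (x ^ (2 ^ k)))\<^sup>2"
    using norm_mult_self[OF selfadjoint_power[OF assms]] by simp
  then show ?case using Suc by (simp flip: power_mult add: mult.commute)
qed simp

lemma scaleC_zero_right [simp]: "scaleC c (0::'a::cstar_algebra) = 0"
  using scaleC_add_right[of c "0::'a" 0] by simp

lemma scaleC_minus_right [simp]: "scaleC c (- (x::'a::cstar_algebra)) = - scaleC c x"
  using scaleC_add_right[of c x "- x"] by (simp add: eq_neg_iff_add_eq_0 add.commute)

lemma scaleC_diff_right: "scaleC c ((x::'a::cstar_algebra) - y) = scaleC c x - scaleC c y"
  using scaleC_add_right[of c x "- y"] by simp

lemma scaleC_scaleR_right: "scaleC c (r *\<^sub>R (x::'a::cstar_algebra)) = r *\<^sub>R scaleC c x"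
  by (simp add: scaleC_scaleC mult.commute flip: scaleC_scaleR)

lemma scaleC_sum_right: "scaleC c (\<Sum>i\<in>A. h i) = (\<Sum>i\<in>A. scaleC c (h i :: 'a::cstar_algebra))"
  by (induction A rule: infinite_finite_induct) (simp_all add: scaleC_add_right)

lemmas scaleC_algebra =
  mult_scaleC_left mult_scaleC_right scaleC_scaleC scaleC_add_right scaleC_diff_right
  scaleC_scaleR_right adj_scaleC adj_add adj_diff adj_mult adj_adj adj_scaleR

lemma cartesian_decomposition:
  fixes x :: "'a::cstar_algebra"
  obtains h k where "selfadjoint h" "selfadjoint k" "x = h + scaleC \<i> k"
proof
  let ?h = "(1/2) *\<^sub>R (x + adj x)" and ?k = "scaleC \<i> ((1/2) *\<^sub>R (adj x - x))"
  show "selfadjoint ?h" by (simp add: selfadjoint_def scaleC_algebra add.commute)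
  show "selfadjoint ?k" by (simp add: selfadjoint_def scaleC_algebra algebra_simps)
  have "?h + scaleC \<i> ?k = (1/2) *\<^sub>R x + (1/2) *\<^sub>R x" by (simp add: scaleC_scaleC algebra_simps)
  then show "x = ?h + scaleC \<i> ?k" by (simp flip: scaleR_left.add)
qed

lemma adj_cartesian:
  "selfadjoint h \<Longrightarrow> selfadjoint k \<Longrightarrow> adj (h + scaleC \<i> k) = h - scaleC \<i> (k::'a::cstar_algebra)"
  by (simp add: scaleC_algebra selfadjointD)

subsection \<open>Invertibility and spectra\<close>

lemma cinvertibleI: "x * y = 1 \<Longrightarrow> y * x = 1 \<Longrightarrow> cinvertible x"
  by (auto simp: cinvertible_def)

lemma cinv_mult: "cinvertible x \<Longrightarrow> x * cinv x = 1" "cinvertible x \<Longrightarrow> cinv x * x = 1"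
  unfolding cinvertible_def cinv_def by (metis (mono_tags, lifting) someI_ex)+

lemma cinvertible_mult:
  assumes "cinvertible x" "cinvertible y" shows "cinvertible (x * (y::'a::cstar_algebra))"
proof (rule cinvertibleI)
  have "x * y * (cinv y * cinv x) = x * (y * cinv y) * cinv x"
    "cinv y * cinv x * (x * y) = cinv y * (cinv x * x) * y" by (simp_all only: mult.assoc)
  then show "x * y * (cinv y * cinv x) = 1" "cinv y * cinv x * (x * y) = 1"
    using cinv_mult[OF assms(1)] cinv_mult[OF assms(2)] by simp_all
qed

lemma cinvertible_minus_iff: "cinvertible (- x) \<longleftrightarrow> cinvertible (x::'a::cstar_algebra)"
  unfolding cinvertible_def by (metis minus_mult_minus minus_minus)

lemma cinvertible_scaleR:
  assumes "cinvertible (x::'a::cstar_algebra)" "r \<noteq> 0" shows "cinvertible (r *\<^sub>R x)"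
  using cinv_mult[OF assms(1)] assms(2) by (intro cinvertibleI[of _ "(1 / r) *\<^sub>R cinv x"]) auto

lemma not_cinvertible_zero [simp]: "\<not> cinvertible (0::'a::cstar_algebra)"
  by (simp add: cinvertible_def)

lemma cinv_selfadjoint:
  assumes "cinvertible x" "selfadjoint (x::'a::cstar_algebra)" shows "selfadjoint (cinv x)"
proof -
  have "adj (cinv x) * x = 1" using arg_cong[OF cinv_mult(1)[OF assms(1)], of adj] assms(2)
    by (simp add: adj_mult selfadjointD)
  then have "adj (cinv x) * (x * cinv x) = cinv x" by (simp flip: mult.assoc)
  then show ?thesis using cinv_mult(1)[OF assms(1)] by (simp add: selfadjoint_def)
qed

text \<open>The inverse is the Neumann series, which converges by completeness; its partial sums
  telescope on both sides.\<close>

lemma cinvertible_one_minus: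
  assumes "norm (x::'a::cstar_algebra) < 1" shows "cinvertible (1 - x)"
proof -
  have s: "summable (\<lambda>n. x ^ n)" by (rule complete_algebra_summable_geometric[OF assms])
  have x0: "(\<lambda>n. x ^ n) \<longlonglongrightarrow> 0" by (rule summable_LIMSEQ_zero[OF s])
  have l: "(\<lambda>n. \<Sum>i<n. x ^ i) \<longlonglongrightarrow> suminf (\<lambda>n. x ^ n)" by (rule summable_LIMSEQ[OF s])
  have e: "(1 - x) * (\<Sum>i<n. x ^ i) = 1 - x ^ n \<and> (\<Sum>i<n. x ^ i) * (1 - x) = 1 - x ^ n" for n
  proof (induction n)
    case (Suc n)
    have "(1 - x) * (\<Sum>i<Suc n. x ^ i) = (1 - x) * (\<Sum>i<n. x ^ i) + (x ^ n - x * x ^ n)"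
      "(\<Sum>i<Suc n. x ^ i) * (1 - x) = (\<Sum>i<n. x ^ i) * (1 - x) + (x ^ n - x ^ n * x)"
      by (simp_all add: distrib_left distrib_right left_diff_distrib right_diff_distrib)
    then show ?case using Suc by (simp add: power_commutes)
  qed simp
  have t: "(\<lambda>n. 1 - x ^ n) \<longlonglongrightarrow> 1" using tendsto_diff[OF tendsto_const x0, of 1] by simp
  show ?thesis
  proof (rule cinvertibleI)
    show "(1 - x) * suminf (\<lambda>n. x ^ n) = 1"
      using tendsto_mult[OF tendsto_const l, of "1 - x"] t e LIMSEQ_unique by simp
    show "suminf (\<lambda>n. x ^ n) * (1 - x) = 1"
      using tendsto_mult[OF l tendsto_const, of "1 - x"] t e LIMSEQ_unique by simp
  qed
qed

text \<open>Formally \<open>1 + y x + y x y x + ...\<close> is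
  \<open>1 + y (1 + x y + ...) x\<close>, which suggests the inverse used here. It links the spectra
  of \<open>adj z * z\<close> and \<open>z * adj z\<close>.\<close>

lemma cinvertible_swap:
  assumes "cinvertible (1 - x * y)" shows "cinvertible (1 - y * (x::'a::cstar_algebra))"
proof -
  let ?z = "cinv (1 - x * y)"
  have 1: "?z - x * y * ?z = 1" "?z - ?z * x * y = 1"
    using cinv_mult[OF assms] by (simp_all add: algebra_simps)
  have "(1 - y * x) * (1 + y * ?z * x) = 1 - y * x + y * (?z - x * y * ?z) * x"
    by (simp add: algebra_simps)
  moreover have "(1 + y * ?z * x) * (1 - y * x) = 1 - y * x + y * (?z - ?z * x * y) * x"
    by (simp add: algebra_simps)
  ultimately show ?thesis using 1 by (intro cinvertibleI[of _ "1 + y * ?z * x"]) simp_all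
qed

lemma mem_real_spectrum: "t \<in> real_spectrum x \<longleftrightarrow> \<not> cinvertible (x - t *\<^sub>R 1)"
  by (simp add: real_spectrum_def cspectrum_def scaleC_scaleR)

lemma norm_less_imp_cinvertible:
  assumes "norm (x::'a::cstar_algebra) < cmod c" shows "cinvertible (x - scaleC c 1)"
proof -
  have c: "c \<noteq> 0" using assms norm_ge_zero[of x] by fastforce
  let ?d = "scaleC (1 / c) 1 :: 'a" and ?e = "scaleC c 1 :: 'a"
  have "norm (scaleC (1 / c) x) < 1"
    using assms c by (simp add: norm_scaleC norm_divide divide_simps)
  then have i: "cinvertible (1 - scaleC (1 / c) x)" by (rule cinvertible_one_minus)
  have "cinvertible ?e"
    by (rule cinvertibleI[of _ ?d]) (simp_all add: mult_scaleC_left mult_scaleC_right scaleC_scaleC c)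
  then have "cinvertible (- (?e * (1 - scaleC (1 / c) x)))"
    using i by (simp only: cinvertible_minus_iff cinvertible_mult)
  also have "- (?e * (1 - scaleC (1 / c) x)) = x - ?e"
    by (simp add: right_diff_distrib mult_scaleC_left scaleC_scaleC c)
  finally show ?thesis .
qed

lemma cspectrum_norm_le: "c \<in> cspectrum x \<Longrightarrow> cmod c \<le> norm x"
  unfolding cspectrum_def using norm_less_imp_cinvertible not_less by blast

lemma real_spectrum_norm_le: "t \<in> real_spectrum x \<Longrightarrow> \<bar>t\<bar> \<le> norm x"
  using cspectrum_norm_le[of "complex_of_real t" x] by (simp add: real_spectrum_def)

text \<open>Shifting by an imaginary scalar: the squared norm of \<open>x + i t\<close> grows at
  most like \<open>(norm x)\<^sup>2 + t\<^sup>2\<close>, while a spectral point with nonzero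
  imaginary part would make it grow by a further term linear in \<open>t\<close>.\<close>

lemma selfadjoint_cspectrum_real:
  assumes x: "selfadjoint (x::'a::cstar_algebra)" and c: "c \<in> cspectrum x"
  shows "Im c = 0"
proof (rule ccontr)
  assume b: "Im c \<noteq> 0"
  \<comment> \<open>Chosen so that \<open>2 * Im c * t\<close> exceeds
    \<open>(norm x)\<^sup>2\<close> by exactly 1.\<close>
  define t where "t = ((norm x)\<^sup>2 + 1) / (2 * Im c)"
  let ?y = "x + scaleC \<i> (t *\<^sub>R 1)"
  have "adj ?y * ?y = x * x + (t * t) *\<^sub>R 1"
    using x by (simp add: scaleC_algebra selfadjointD algebra_simps)
  then have "(norm ?y)\<^sup>2 \<le> (norm x)\<^sup>2 + t\<^sup>2"
    using norm_triangle_ineq[of "x * x" "(t * t) *\<^sub>R 1"] norm_mult_self[OF x] cstar_identity[of ?y]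
    by (simp add: power2_eq_square)
  also have "\<dots> < (Re c)\<^sup>2 + (Im c + t)\<^sup>2"
  proof -
    have "2 * Im c * t = (norm x)\<^sup>2 + 1" using b by (simp add: t_def)
    then have "(Im c + t)\<^sup>2 = (Im c)\<^sup>2 + (norm x)\<^sup>2 + 1 + t\<^sup>2" by (simp add: power2_sum)
    then show ?thesis by (smt (verit) zero_le_power2)
  qed
  also have "\<dots> = (cmod (c + \<i> * t))\<^sup>2" by (simp add: cmod_power2)
  finally have "norm ?y < cmod (c + \<i> * t)"
    using power_less_imp_less_base norm_ge_zero by blast
  then have "cinvertible (?y - scaleC (c + \<i> * t) 1)"
    by (rule norm_less_imp_cinvertible)
  moreover have "scaleC (\<i> * t) 1 = scaleC \<i> (t *\<^sub>R (1::'a))"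
    by (simp flip: scaleC_scaleC scaleC_scaleR)
  ultimately show False using c by (simp add: scaleC_add_left cspectrum_def)
qed

lemma selfadjoint_cspectrum_eq:
  assumes "selfadjoint x" shows "cspectrum x = complex_of_real ` real_spectrum x"
proof -
  have "c = complex_of_real (Re c)" if "c \<in> cspectrum x" for c
    using selfadjoint_cspectrum_real[OF assms that] by (simp add: complex_eq_iff)
  then show ?thesis unfolding real_spectrum_def by force
qed

section \<open>Attainment of the norm on the spectrum of a self-adjoint element\<close>

text \<open>\<open>a\<close> is the real part of the normal element \<open>a + i b\<close>, whose
  squared norm is that of \<open>a * a + b * b\<close>; taking real parts does not increase the
  norm. No spectral information enters.\<close>

lemma norm_add_squares_ge:
  assumes "selfadjoint (a::'a::cstar_algebra)" "selfadjoint b" "a * b = b * a"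
  shows "norm (a * a) \<le> norm (a * a + b * b)"
proof -
  let ?y = "a + scaleC \<i> b"
  have "adj ?y * ?y = a * a + b * b"
    using assms by (simp add: scaleC_algebra selfadjointD algebra_simps)
  then have "norm (a * a + b * b) = (norm ?y)\<^sup>2" using cstar_identity[of ?y] by simp
  moreover have "norm (2 *\<^sub>R a) \<le> 2 * norm ?y"
  proof -
    have "2 *\<^sub>R a = ?y + adj ?y" using assms by (simp add: adj_cartesian scaleR_2)
    then show ?thesis using norm_triangle_ineq[of ?y "adj ?y"] by (simp add: norm_adj)
  qed
  ultimately show ?thesis using norm_mult_self[OF assms(1)] by (simp add: power_mono)
qed

text \<open>The identity \<open>(2 a)\<^sup>2 + (1 - a\<^sup>2)\<^sup>2 = (1 +
  a\<^sup>2)\<^sup>2\<close>, multiplied by \<open>s\<^sup>2\<close>, writes the square of the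
  right-hand element as a sum of commuting squares.\<close>

lemma norm_mult_one_plus_square_ge:
  assumes s: "selfadjoint (s::'a::cstar_algebra)" and a: "selfadjoint a" and c: "s * a = a * s"
  shows "2 * norm (s * a) \<le> norm (s * (1 + a * a))"
proof -
  let ?u = "2 *\<^sub>R (s * a)" and ?w = "s * (1 - a * a)" and ?v = "s * (1 + a * a)"
  have c2: "s * (a * a) = a * a * s" by (metis c mult.assoc)
  have sa: "selfadjoint ?u" "selfadjoint ?w" "selfadjoint ?v"
    using s a c c2 by (auto intro!: selfadjoint_scaleR selfadjoint_mult selfadjoint_add selfadjoint_diff
        simp: distrib_left distrib_right left_diff_distrib right_diff_distrib)
  have cl: "a * (s * y) = s * (a * y)" for y by (metis c mult.assoc)
  have "?u * ?w = ?w * ?u" "?u * ?u + ?w * ?w = ?v * ?v"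
    by (simp_all add: distrib_left distrib_right left_diff_distrib right_diff_distrib mult.assoc cl
        flip: c) (simp_all add: scaleR_conv_of_real algebra_simps flip: mult_2)
  then have "(norm ?u)\<^sup>2 \<le> (norm ?v)\<^sup>2"
    using norm_add_squares_ge[OF sa(1,2)] norm_mult_self[OF sa(1)] norm_mult_self[OF sa(3)] by simp
  then have "norm ?u \<le> norm ?v" by (rule power2_le_imp_le) simp
  then show ?thesis by simp
qed

lemma not_cinvertible_one_minus_square:
  assumes x: "selfadjoint (x::'a::cstar_algebra)" and n1: "norm x = 1"
  shows "\<not> cinvertible (1 - x * x)"
proof
  assume inv: "cinvertible (1 - x * x)"
  \<comment> \<open>The geometric sum of \<open>x ^ (2 * m)\<close> over \<open>m < 2 ^ k\<close>,
    in factored form. \<open>rev\<close> puts the newest factor on the left, as in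
    \<open>PS\<close>.\<close>
  define P where "P k = (\<Prod>j\<leftarrow>rev [0..<k]. 1 + x ^ (2 ^ Suc j))" for k
  have P0: "P 0 = 1" by (simp add: P_def)
  have PS: "P (Suc k) = (1 + x ^ (2 ^ Suc k)) * P k" for k by (simp add: P_def)
  have sq: "x ^ (2 ^ Suc k) = x ^ (2 ^ k) * x ^ (2 ^ k)" for k
    by (simp add: mult_2 flip: power_add)
  have cp: "P k * x ^ m = x ^ m * P k" for k m
  proof (induction k)
    case (Suc k)
    have "P (Suc k) * x ^ m = ((1 + x ^ (2 ^ Suc k)) * x ^ m) * P k"
      by (simp only: PS mult.assoc Suc)
    also have "(1 + x ^ (2 ^ Suc k)) * x ^ m = x ^ m * (1 + x ^ (2 ^ Suc k))"
      by (simp add: distrib_left distrib_right add.commute flip: power_add)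
    finally show ?case by (simp only: PS mult.assoc)
  qed (simp add: P0)
  have saP: "selfadjoint (P k)" for k
    by (induction k) (auto simp: P0 PS distrib_left distrib_right cp
        intro!: selfadjoint_mult selfadjoint_add selfadjoint_power x simp del: power_Suc)
  have telescope: "P k * (1 - x * x) = 1 - x ^ (2 ^ Suc k)" for k
  proof (induction k)
    case (Suc k)
    have "P (Suc k) * (1 - x * x) = (1 + x ^ (2 ^ Suc k)) * (1 - x ^ (2 ^ Suc k))"
      by (simp only: PS mult.assoc Suc)
    also have "\<dots> = 1 - x ^ (2 ^ Suc (Suc k))" unfolding sq[of "Suc k"] by (simp add: algebra_simps)
    finally show ?case .
  qed (simp add: P0 power2_eq_square)
  \<comment> \<open>AM-GM \<open>1 + a\<^sup>2 \<ge> 2 a\<close>: each factor of \<open>P\<close> contributes a factor 2 to the norm.\<close>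
  have grow: "2 ^ k * norm (x ^ (2 ^ k - 1 + m)) \<le> norm (P k * x ^ m)" for k m
  \<comment> \<open>\<open>m\<close> is generalised because replacing the outermost factor by
    \<open>2 * x ^ (2 ^ k)\<close> moves that power into the tail.\<close>
  proof (induction k arbitrary: m)
    case (Suc k)
    let ?a = "x ^ (2 ^ k)" and ?s = "P k * x ^ m"
    have "?s * ?a = P k * x ^ (2 ^ k + m)" by (simp add: mult.assoc add.commute flip: power_add)
    moreover have "2 ^ k - 1 + (2 ^ k + m) = 2 ^ Suc k - 1 + m" by simp
    ultimately have "2 ^ Suc k * norm (x ^ (2 ^ Suc k - 1 + m)) \<le> 2 * norm (?s * ?a)"
      using Suc[of "2 ^ k + m"] by (simp only: power_Suc)
    also have "\<dots> \<le> norm (?s * (1 + ?a * ?a))"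
    proof (rule norm_mult_one_plus_square_ge)
      show "selfadjoint ?s" "selfadjoint ?a"
        by (auto intro!: selfadjoint_mult saP selfadjoint_power x cp)
      have "?s * ?a = P k * x ^ (2 ^ k) * x ^ m" by (simp add: mult.assoc add.commute flip: power_add)
      then show "?s * ?a = ?a * ?s" by (simp only: cp[of k "2 ^ k"] mult.assoc)
    qed
    also have "?s * (1 + ?a * ?a) = P (Suc k) * x ^ m"
    proof -
      have "?s * (1 + ?a * ?a) = (P k * (1 + x ^ (2 ^ Suc k))) * x ^ m"
        unfolding sq[symmetric] by (simp add: distrib_left distrib_right mult.assoc add.commute flip: power_add)
      also have "P k * (1 + x ^ (2 ^ Suc k)) = P (Suc k)"
        by (simp only: PS distrib_left distrib_right cp mult_1_left mult_1_right)
      finally show ?thesis .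
    qed
    finally show ?case .
  qed (simp add: P0)
  let ?z = "cinv (1 - x * x)"
  \<comment> \<open>Lower and upper estimates of \<open>norm (P k)\<close> collide:
    \<open>grow\<close> gives at least \<open>2 ^ k\<close>, \<open>telescope\<close> gives at most
    \<open>2 * norm ?z\<close>.\<close>
  have bound: "2 ^ k \<le> 2 * norm ?z" for k
  proof -
    have "1 = norm (x ^ (2 ^ k))" using norm_power_two_power[OF x] n1 by simp
    also have "x ^ (2 ^ k) = x ^ (2 ^ k - 1) * x" by (metis power_minus_mult zero_less_numeral zero_less_power)
    also have "norm \<dots> \<le> norm (x ^ (2 ^ k - 1))" using norm_mult_ineq[of _ x] n1 by simp
    finally have "2 ^ k \<le> 2 ^ k * norm (x ^ (2 ^ k - 1 + 0))" by simp
    also have "\<dots> \<le> norm (P k)" using grow[of k 0] by simp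
    also have "P k = (1 - x ^ (2 ^ Suc k)) * ?z"
      by (simp only: telescope[symmetric] mult.assoc cinv_mult[OF inv] mult_1_right)
    also have "norm \<dots> \<le> norm (1 - x ^ (2 ^ Suc k)) * norm ?z" by (rule norm_mult_ineq)
    also have "norm (1 - x ^ (2 ^ Suc k)) \<le> 2"
      using norm_triangle_ineq4[of 1 "x ^ (2 ^ Suc k)"] norm_power_two_power[OF x, of "Suc k"] n1 by simp
    finally show ?thesis by (simp add: mult_right_mono)
  qed
  obtain k where "2 * norm ?z < 2 ^ k" using real_arch_pow[of 2] by auto
  with bound[of k] show False by simp
qed

text \<open>After normalisation to \<open>y\<close> of norm 1, \<open>1 - y * y\<close> is not
  invertible and factors as \<open>- (y - 1) * (y + 1)\<close>, so one of the factors is not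
  invertible.\<close>

proposition selfadjoint_norm_attained:
  assumes "selfadjoint (x::'a::cstar_algebra)"
  obtains t where "t \<in> real_spectrum x" "\<bar>t\<bar> = norm x"
proof (cases "x = 0")
  case True
  then have "0 \<in> real_spectrum x" by (simp add: mem_real_spectrum)
  with True that show ?thesis by simp
next
  case False
  let ?r = "norm x" and ?y = "(1 / norm x) *\<^sub>R x"
  have "\<not> cinvertible (1 - ?y * ?y)"
    using False by (intro not_cinvertible_one_minus_square selfadjoint_scaleR assms) simp
  moreover have "1 - ?y * ?y = (- (1 / ?r) *\<^sub>R (x - ?r *\<^sub>R 1)) * ((1 / ?r) *\<^sub>R (x - (- ?r) *\<^sub>R 1))"
    using False by (simp add: algebra_simps)
  ultimately have "\<not> cinvertible (x - ?r *\<^sub>R 1) \<or> \<not> cinvertible (x - (- ?r) *\<^sub>R 1)"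
    using False cinvertible_mult cinvertible_scaleR by (metis divide_eq_0_iff neg_equal_0_iff_equal norm_eq_zero zero_neq_one)
  then show ?thesis using that[of ?r] that[of "- ?r"] by (auto simp: mem_real_spectrum)
qed

subsection \<open>Polynomial functional calculus\<close>

text \<open>Complex coefficients are needed to split off linear factors; the Horner form lets the
  algebraic laws follow by induction on \<open>pCons\<close>.\<close>

definition cpolyeval :: "complex poly \<Rightarrow> 'a::cstar_algebra \<Rightarrow> 'a" where
  "cpolyeval p x = fold_coeffs (\<lambda>c y. scaleC c 1 + x * y) p 0"

lemma cpolyeval_0 [simp]: "cpolyeval 0 x = 0"
  by (simp add: cpolyeval_def)

lemma cpolyeval_pCons [simp]: "cpolyeval (pCons c p) x = scaleC c 1 + x * cpolyeval p x"
  by (cases "p = 0 \<and> c = 0") (auto simp: cpolyeval_def)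

lemma cpolyeval_add: "cpolyeval (p + q) x = cpolyeval p x + cpolyeval q x"
  by (induction p q rule: poly_induct2) (simp_all add: scaleC_add_left algebra_simps)

lemma cpolyeval_smult: "cpolyeval (smult c p) x = scaleC c (cpolyeval p x)"
  by (induction p) (simp_all add: scaleC_algebra)

lemma cpolyeval_mult: "cpolyeval (p * q) x = cpolyeval p x * cpolyeval q x"
  by (induction p) (simp_all add: cpolyeval_add cpolyeval_smult algebra_simps mult_scaleC_left)

text \<open>One half of spectral mapping. A root \<open>c\<close> of \<open>p\<close> splits off a
  factor \<open>x - c\<close>; either this factor is singular, so that \<open>c\<close> is spectral,
  or the quotient is and the induction applies.\<close>

lemma not_cinvertible_cpolyeval:
  assumes "p \<noteq> 0" "\<not> cinvertible (cpolyeval p x)"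
  shows "\<exists>c\<in>cspectrum x. poly p c = 0"
  using assms
proof (induction "degree p" arbitrary: p)
  case 0
  then obtain c where c: "p = [:c:]" "c \<noteq> 0" by (metis degree_eq_zeroE pCons_0_0)
  then have "cinvertible (cpolyeval p x)"
    by (intro cinvertibleI[of _ "scaleC (1 / c) 1"]) (simp_all add: scaleC_algebra)
  with 0 show ?case by simp
next
  case (Suc n)
  then have "\<not> constant (poly p)" by (simp add: constant_degree)
  then obtain c where c: "poly p c = 0" using fundamental_theorem_of_algebra by blast
  then obtain q where q: "p = [:- c, 1:] * q" by (metis poly_eq_0_iff_dvd dvdE)
  with Suc.prems have q0: "q \<noteq> 0" by auto
  with Suc.hyps(2) q have dq: "n = degree q" by (simp add: degree_mult_eq del: mult_pCons_left)
  have e: "cpolyeval p x = (x - scaleC c 1) * cpolyeval q x" by (simp only: q cpolyeval_mult) simp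
  show ?case
  proof (cases "cinvertible (cpolyeval q x)")
    case True
    with e Suc.prems(2) have "c \<in> cspectrum x" using cinvertible_mult by (auto simp: cspectrum_def)
    with c show ?thesis by blast
  next
    case False
    from Suc.hyps(1)[OF dq q0 False] show ?thesis unfolding q by auto
  qed
qed

lemma polyeval_altdef: "degree p \<le> n \<Longrightarrow> polyeval p x = (\<Sum>i\<le>n. coeff p i *\<^sub>R x ^ i)"
  unfolding polyeval_def by (intro sum.mono_neutral_left) (auto simp: coeff_eq_0)

lemma polyeval_conv_cpolyeval: "polyeval p x = cpolyeval (map_poly complex_of_real p) x"
proof (induction p)
  case (pCons a p)
  have "polyeval (pCons a p) x = a *\<^sub>R 1 + x * polyeval p x"
    unfolding polyeval_altdef[OF degree_pCons_le] sum.atMost_Suc_shift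
    by (simp add: polyeval_def sum_distrib_left)
  with pCons show ?case by (simp add: map_poly_pCons scaleC_scaleR)
qed (simp add: polyeval_def)

lemma polyeval_0 [simp]: "polyeval 0 x = 0"
  and polyeval_const [simp]: "polyeval [:c:] x = c *\<^sub>R 1"
  by (simp_all add: polyeval_def)

lemma polyeval_pCons [simp]: "polyeval (pCons a p) x = a *\<^sub>R 1 + x * polyeval p x"
  by (simp add: polyeval_conv_cpolyeval map_poly_pCons scaleC_scaleR)

lemma polyeval_add: "polyeval (p + q) x = polyeval p x + polyeval q x"
  by (induction p q rule: poly_induct2) (simp_all add: algebra_simps)

lemma polyeval_smult: "polyeval (smult c p) x = c *\<^sub>R polyeval p x"
  by (induction p) (simp_all add: algebra_simps)

lemma polyeval_diff: "polyeval (p - q) x = polyeval p x - polyeval q x"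
  using polyeval_add[of p "- q" x] polyeval_smult[of "-1" q x] by simp

lemma polyeval_mult: "polyeval (p * q) x = polyeval p x * polyeval q x"
  by (induction p) (simp_all add: polyeval_add polyeval_smult algebra_simps)

lemma selfadjoint_polyeval: "selfadjoint x \<Longrightarrow> selfadjoint (polyeval p x)"
  unfolding polyeval_def by (intro selfadjoint_sum selfadjoint_scaleR selfadjoint_power)

lemma norm_polyeval_attained:
  assumes x: "selfadjoint x"
  shows "\<exists>s\<in>real_spectrum x. norm (polyeval p x) = \<bar>poly p s\<bar>"
proof -
  obtain t where t: "t \<in> real_spectrum (polyeval p x)" "\<bar>t\<bar> = norm (polyeval p x)"
    using selfadjoint_norm_attained[OF selfadjoint_polyeval[OF x]] .
  \<comment> \<open>The spectrum is non-empty; \<open>s0\<close> serves the degenerate case in which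
    \<open>p\<close> is the constant \<open>t\<close>.\<close>
  obtain s0 where s0: "s0 \<in> real_spectrum x" using selfadjoint_norm_attained[OF x] .
  let ?q = "p - [:t:]"
  have "polyeval ?q x = polyeval p x - t *\<^sub>R 1" by (simp only: polyeval_diff polyeval_const)
  then have ni: "\<not> cinvertible (cpolyeval (map_poly of_real ?q) x)"
    using t(1) by (simp add: mem_real_spectrum flip: polyeval_conv_cpolyeval)
  have "\<exists>s\<in>real_spectrum x. poly ?q s = 0"
  proof (cases "?q = 0")
    case False
    then have "map_poly complex_of_real ?q \<noteq> 0" by (simp add: map_poly_eq_0_iff)
    from not_cinvertible_cpolyeval[OF this ni]
    obtain c where "c \<in> cspectrum x" "poly (map_poly complex_of_real ?q) c = 0" by blast
    then obtain s where s: "s \<in> real_spectrum x" "poly (map_poly complex_of_real ?q) (complex_of_real s) = 0"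
      using selfadjoint_cspectrum_eq[OF x] by auto
    have "poly (map_poly complex_of_real r) (complex_of_real s) = complex_of_real (poly r s)" for r
      by (induction r) (simp_all add: map_poly_pCons)
    with s show ?thesis by (metis of_real_eq_0_iff)
  next
    case True
    with s0 show ?thesis by (metis poly_0)
  qed
  then obtain s where "s \<in> real_spectrum x" "poly p s = t" by auto
  with t(2) show ?thesis by metis
qed

lemma norm_polyeval_le:
  assumes "selfadjoint x" "\<And>s. s \<in> real_spectrum x \<Longrightarrow> \<bar>poly p s\<bar> \<le> e"
  shows "norm (polyeval p x) \<le> e"
  using norm_polyeval_attained[OF assms(1), of p] assms(2) by force

subsection \<open>Continuous functional calculus\<close>

lemma compact_real_spectrum: "compact (real_spectrum (x::'a::cstar_algebra))"
proof -
  have "bounded (real_spectrum x)"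
    unfolding bounded_iff using real_spectrum_norm_le by auto
  moreover have "open (- real_spectrum x)"
    unfolding open_dist
  proof safe
    fix t assume "t \<notin> real_spectrum x"
    then have i: "cinvertible (x - t *\<^sub>R 1)" by (simp add: mem_real_spectrum)
    let ?y = "cinv (x - t *\<^sub>R 1)"
    \<comment> \<open>This radius makes \<open>(s - t) *\<^sub>R ?y\<close> a strict contraction;
      the \<open>+ 1\<close> keeps the denominator positive.\<close>
    have "s \<notin> real_spectrum x" if "dist s t < 1 / (norm ?y + 1)" for s
    proof -
      have "\<bar>s - t\<bar> * (norm ?y + 1) < 1"
        using that by (simp add: dist_real_def pos_less_divide_eq add_nonneg_pos)
      then have "norm ((s - t) *\<^sub>R ?y) < 1" by (smt (verit) mult_left_mono norm_scaleR abs_ge_zero)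
      then have "cinvertible ((x - t *\<^sub>R 1) * (1 - (s - t) *\<^sub>R ?y))"
        by (intro cinvertible_mult i cinvertible_one_minus)
      also have "(x - t *\<^sub>R 1) * (1 - (s - t) *\<^sub>R ?y) = x - t *\<^sub>R 1 - (s - t) *\<^sub>R ((x - t *\<^sub>R 1) * ?y)"
        by (simp add: algebra_simps)
      also have "\<dots> = x - s *\<^sub>R 1" by (simp only: cinv_mult[OF i]) (simp add: algebra_simps)
      finally show ?thesis by (simp add: mem_real_spectrum)
    qed
    then show "\<exists>e>0. \<forall>s. dist s t < e \<longrightarrow> s \<in> - real_spectrum x"
      by (intro exI[of _ "1 / (norm ?y + 1)"]) (auto simp: add_nonneg_pos)
  qed
  ultimately show ?thesis by (simp add: compact_eq_bounded_closed closed_def)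
qed

text \<open>Stone-Weierstrass, with polynomial functions converted to the type
  \<open>real poly\<close> over which \<open>cfc\<close> quantifies.\<close>

lemma uniform_approximation_by_poly:
  fixes h :: "real \<Rightarrow> real"
  assumes "compact S" "continuous_on S h"
  obtains ps :: "nat \<Rightarrow> real poly" where "uniform_limit S (\<lambda>n t. poly (ps n) t) h sequentially"
proof -
  obtain q where q: "uniform_limit S q h sequentially" "\<And>n. polynomial_function (q n)"
    using Stone_Weierstrass_uniform_limit[OF assms] by (metis (no_types))
  have "\<exists>p. poly p = q n" for n
  proof -
    obtain a m where am: "q n = (\<lambda>t. \<Sum>i\<le>m. a i * t ^ i)"
      using q(2)[of n] real_polynomial_function_iff_sum[of "q n"] real_polynomial_function_eq[of "q n"]
      by auto
    have "poly (\<Sum>i\<le>m. monom (a i) i) = q n" by (simp add: am fun_eq_iff poly_sum poly_monom)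
    then show ?thesis by blast
  qed
  then obtain ps where "\<And>n. poly (ps n) = q n" by metis
  with q(1) that[of ps] show thesis by simp
qed

text \<open>Two sequences at once: equal ones give the Cauchy property, different ones the
  independence of the limit from the approximation.\<close>

lemma polyeval_close:
  assumes x: "selfadjoint x"
    and "uniform_limit (real_spectrum x) (\<lambda>n t. poly (ps n) t) h sequentially"
    and "uniform_limit (real_spectrum x) (\<lambda>n t. poly (qs n) t) h sequentially" and e: "e > 0"
  shows "\<exists>N. \<forall>m\<ge>N. \<forall>n\<ge>N. norm (polyeval (ps m) x - polyeval (qs n) x) \<le> e"
proof -
  obtain N where N: "\<And>n s. n \<ge> N \<Longrightarrow> s \<in> real_spectrum x \<Longrightarrow>
      \<bar>poly (ps n) s - h s\<bar> < e / 2 \<and> \<bar>poly (qs n) s - h s\<bar> < e / 2"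
    using eventually_conj[OF uniform_limitD[OF assms(2), of "e / 2"] uniform_limitD[OF assms(3), of "e / 2"]] e
    by (auto simp: eventually_sequentially dist_real_def)
  have "norm (polyeval (ps m) x - polyeval (qs n) x) \<le> e" if "m \<ge> N" "n \<ge> N" for m n
    unfolding polyeval_diff[symmetric]
  proof (rule norm_polyeval_le[OF x])
    show "\<bar>poly (ps m - qs n) s\<bar> \<le> e" if "s \<in> real_spectrum x" for s
      using N[OF \<open>m \<ge> N\<close> that] N[OF \<open>n \<ge> N\<close> that] by (simp add: abs_if split: if_splits)
  qed
  then show ?thesis by blast
qed

text \<open>This makes the definite description in \<open>cfc\<close> meaningful: completeness
  yields a limit, all approximations share it, and the given one shows that it is unique.\<close>

lemma polyeval_tendsto_cfc:
  assumes x: "selfadjoint x" and h: "continuous_on (real_spectrum x) h"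
    and lim: "uniform_limit (real_spectrum x) (\<lambda>n t. poly (ps n) t) h sequentially"
  shows "(\<lambda>n. polyeval (ps n) x) \<longlonglongrightarrow> cfc h x"
proof -
  have "Cauchy (\<lambda>n. polyeval (ps n) x)"
  proof (rule metric_CauchyI)
    fix e :: real assume "e > 0"
    then obtain N where "\<forall>m\<ge>N. \<forall>n\<ge>N. norm (polyeval (ps m) x - polyeval (ps n) x) \<le> e / 2"
      using polyeval_close[OF x lim lim, of "e / 2"] by auto
    with \<open>e > 0\<close> show "\<exists>M. \<forall>m\<ge>M. \<forall>n\<ge>M. dist (polyeval (ps m) x) (polyeval (ps n) x) < e"
      by (intro exI[of _ N]) (fastforce simp: dist_norm)
  qed
  then obtain b where b: "(\<lambda>n. polyeval (ps n) x) \<longlonglongrightarrow> b"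
    using Cauchy_convergent_iff convergent_def by blast
  have all: "(\<lambda>n. polyeval (qs n) x) \<longlonglongrightarrow> b"
    if qs: "uniform_limit (real_spectrum x) (\<lambda>n t. poly (qs n) t) h sequentially" for qs
  proof -
    have "(\<lambda>n. polyeval (qs n) x - polyeval (ps n) x) \<longlonglongrightarrow> 0"
    proof (rule LIMSEQ_I)
      fix e :: real assume "e > 0"
      then obtain N where "\<forall>m\<ge>N. \<forall>n\<ge>N. norm (polyeval (qs m) x - polyeval (ps n) x) \<le> e / 2"
        using polyeval_close[OF x qs lim, of "e / 2"] by auto
      with \<open>e > 0\<close> show "\<exists>N. \<forall>n\<ge>N. norm (polyeval (qs n) x - polyeval (ps n) x - 0) < e"
        by (intro exI[of _ N]) fastforce
    qed
    from tendsto_add[OF this b] show ?thesis by simp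
  qed
  have "cfc h x = b" unfolding cfc_def
  proof (rule the_equality)
    fix c assume "\<forall>ps. uniform_limit (real_spectrum x) (\<lambda>n t. poly (ps n) t) h sequentially \<longrightarrow>
      (\<lambda>n. polyeval (ps n) x) \<longlonglongrightarrow> c"
    with lim b show "c = b" using LIMSEQ_unique by blast
  qed (use all in blast)
  with b show ?thesis by simp
qed

lemma cfc_eqI:
  assumes "selfadjoint x" "continuous_on (real_spectrum x) h"
    and "uniform_limit (real_spectrum x) (\<lambda>n t. poly (ps n) t) h sequentially"
    and "(\<lambda>n. polyeval (ps n) x) \<longlonglongrightarrow> b"
  shows "cfc h x = b"
  by (rule LIMSEQ_unique[OF polyeval_tendsto_cfc[OF assms(1-3)] assms(4)])

lemma cfc_approximation:
  assumes "selfadjoint x" "continuous_on (real_spectrum x) h"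
  obtains ps where "uniform_limit (real_spectrum x) (\<lambda>n t. poly (ps n) t) h sequentially"
    "(\<lambda>n. polyeval (ps n) x) \<longlonglongrightarrow> cfc h x"
proof -
  obtain ps :: "nat \<Rightarrow> real poly"
    where ps: "uniform_limit (real_spectrum x) (\<lambda>n t. poly (ps n) t) h sequentially"
    using uniform_approximation_by_poly[OF compact_real_spectrum assms(2)] .
  show thesis using that[OF ps polyeval_tendsto_cfc[OF assms ps]] .
qed

lemma cfc_cong:
  assumes "\<And>t. t \<in> real_spectrum x \<Longrightarrow> h t = k t" shows "cfc h x = cfc k x"
proof -
  have "uniform_limit (real_spectrum x) (\<lambda>n t. poly (ps n) t) h sequentially \<longleftrightarrow>
      uniform_limit (real_spectrum x) (\<lambda>n t. poly (ps n) t) k sequentially" for ps :: "nat \<Rightarrow> real poly"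
    using assms by (intro uniform_limit_cong') auto
  then show ?thesis unfolding cfc_def by simp
qed

lemma cfc_poly: "selfadjoint x \<Longrightarrow> cfc (poly p) x = polyeval p x"
  by (rule cfc_eqI[of _ _ "\<lambda>_. p"]) (auto intro!: continuous_intros uniform_limit_const)

lemma cfc_const: "selfadjoint x \<Longrightarrow> cfc (\<lambda>_. c) x = c *\<^sub>R 1"
  using cfc_poly[of x "[:c:]"] by (simp add: fun_eq_iff cong: cfc_cong)

lemma cfc_ident: "selfadjoint x \<Longrightarrow> cfc (\<lambda>t. t) x = x"
  using cfc_poly[of x "[:0, 1:]"] by (simp cong: cfc_cong)

lemma selfadjoint_limit:
  assumes "\<And>n. selfadjoint (X n)" "X \<longlonglongrightarrow> (b::'a::cstar_algebra)" shows "selfadjoint b"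
  using LIMSEQ_unique[OF _ assms(2), of "adj b"] tendsto_adj[OF assms(2)] assms(1)
  by (simp add: selfadjoint_def)

lemma selfadjoint_cfc:
  assumes "selfadjoint x" "continuous_on (real_spectrum x) h" shows "selfadjoint (cfc h x)"
  using cfc_approximation[OF assms] selfadjoint_limit[OF selfadjoint_polyeval[OF assms(1)]] by blast

text \<open>One limit argument for \<open>cfc_add\<close>, \<open>cfc_scaleR\<close> and
  \<open>cfc_diff\<close>.\<close>

lemma cfc_scaleR_add:
  assumes "selfadjoint x" "continuous_on (real_spectrum x) h" "continuous_on (real_spectrum x) k"
  shows "cfc (\<lambda>t. r * h t + k t) x = r *\<^sub>R cfc h x + cfc k x"
proof -
  obtain ps where ps: "uniform_limit (real_spectrum x) (\<lambda>n t. poly (ps n) t) h sequentially"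
    "(\<lambda>n. polyeval (ps n) x) \<longlonglongrightarrow> cfc h x" using cfc_approximation[OF assms(1,2)] .
  obtain qs where qs: "uniform_limit (real_spectrum x) (\<lambda>n t. poly (qs n) t) k sequentially"
    "(\<lambda>n. polyeval (qs n) x) \<longlonglongrightarrow> cfc k x" using cfc_approximation[OF assms(1,3)] .
  show ?thesis
  proof (rule cfc_eqI[OF assms(1), of _ "\<lambda>n. smult r (ps n) + qs n"])
    show "uniform_limit (real_spectrum x) (\<lambda>n t. poly (smult r (ps n) + qs n) t) (\<lambda>t. r * h t + k t) sequentially"
      using uniform_limit_add[OF bounded_linear.uniform_limit[OF bounded_linear_mult_right ps(1)] qs(1)]
      by simp
    show "(\<lambda>n. polyeval (smult r (ps n) + qs n) x) \<longlonglongrightarrow> r *\<^sub>R cfc h x + cfc k x"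
      unfolding polyeval_add polyeval_smult by (intro tendsto_intros ps qs)
  qed (intro continuous_intros assms)
qed

lemma cfc_add:
  "selfadjoint x \<Longrightarrow> continuous_on (real_spectrum x) h \<Longrightarrow> continuous_on (real_spectrum x) k \<Longrightarrow>
   cfc (\<lambda>t. h t + k t) x = cfc h x + cfc k x"
  using cfc_scaleR_add[of x h k 1] by simp

lemma cfc_scaleR:
  "selfadjoint x \<Longrightarrow> continuous_on (real_spectrum x) h \<Longrightarrow> cfc (\<lambda>t. r * h t) x = r *\<^sub>R cfc h x"
  using cfc_scaleR_add[of x h "\<lambda>_. 0" r] by (simp add: cfc_const)

lemma cfc_diff:
  "selfadjoint x \<Longrightarrow> continuous_on (real_spectrum x) h \<Longrightarrow> continuous_on (real_spectrum x) k \<Longrightarrow>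
   cfc (\<lambda>t. h t - k t) x = cfc h x - cfc k x"
  using cfc_scaleR_add[of x k h "-1"] by simp

lemma cfc_sum:
  assumes "selfadjoint x" "\<And>i. i \<in> A \<Longrightarrow> continuous_on (real_spectrum x) (h i)"
  shows "cfc (\<lambda>t. \<Sum>i\<in>A. h i t) x = (\<Sum>i\<in>A. cfc (h i) x)"
  using assms(2)
  by (induction A rule: infinite_finite_induct)
    (simp_all add: assms(1) cfc_const cfc_add continuous_on_sum)

lemma cfc_mult:
  assumes "selfadjoint x" "continuous_on (real_spectrum x) h" "continuous_on (real_spectrum x) k"
  shows "cfc (\<lambda>t. h t * k t) x = cfc h x * cfc k x"
proof -
  obtain ps where ps: "uniform_limit (real_spectrum x) (\<lambda>n t. poly (ps n) t) h sequentially"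
    "(\<lambda>n. polyeval (ps n) x) \<longlonglongrightarrow> cfc h x" using cfc_approximation[OF assms(1,2)] .
  obtain qs where qs: "uniform_limit (real_spectrum x) (\<lambda>n t. poly (qs n) t) k sequentially"
    "(\<lambda>n. polyeval (qs n) x) \<longlonglongrightarrow> cfc k x" using cfc_approximation[OF assms(1,3)] .
  show ?thesis
  proof (rule cfc_eqI[OF assms(1), of _ "\<lambda>n. ps n * qs n"])
    show "uniform_limit (real_spectrum x) (\<lambda>n t. poly (ps n * qs n) t) (\<lambda>t. h t * k t) sequentially"
      unfolding poly_mult
      by (intro uniform_lim_mult ps qs compact_imp_bounded compact_continuous_image
          compact_real_spectrum assms)
    show "(\<lambda>n. polyeval (ps n * qs n) x) \<longlonglongrightarrow> cfc h x * cfc k x"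
      unfolding polyeval_mult by (intro tendsto_intros ps qs)
  qed (intro continuous_intros assms)
qed

lemma cfc_commute:
  assumes "selfadjoint x" "continuous_on (real_spectrum x) h" "continuous_on (real_spectrum x) k"
  shows "cfc h x * cfc k x = cfc k x * cfc h x"
  using cfc_mult[OF assms] cfc_mult[OF assms(1,3,2)] by (simp add: mult.commute)

lemma norm_cfc_le:
  assumes "selfadjoint x" "continuous_on (real_spectrum x) h"
    and le: "\<And>t. t \<in> real_spectrum x \<Longrightarrow> \<bar>h t\<bar> \<le> e"
  shows "norm (cfc h x) \<le> e"
proof (rule field_le_epsilon)
  fix d :: real assume d: "d > 0"
  obtain ps where ps: "uniform_limit (real_spectrum x) (\<lambda>n t. poly (ps n) t) h sequentially"
    "(\<lambda>n. polyeval (ps n) x) \<longlonglongrightarrow> cfc h x" using cfc_approximation[OF assms(1,2)] .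
  have "eventually (\<lambda>n. norm (polyeval (ps n) x) \<le> e + d) sequentially"
    using uniform_limitD[OF ps(1) d]
  proof eventually_elim
    case (elim n)
    show ?case
    proof (rule norm_polyeval_le[OF assms(1)])
      fix s assume "s \<in> real_spectrum x"
      with elim le[of s] show "\<bar>poly (ps n) s\<bar> \<le> e + d" by (fastforce simp: dist_real_def)
    qed
  qed
  then show "norm (cfc h x) \<le> e + d"
    using tendsto_upperbound[OF tendsto_norm[OF ps(2)]] by simp
qed

text \<open>Away from the image of \<open>h\<close>, the function \<open>1 / (h s - t)\<close> is
  continuous on the spectrum, and its calculus is the resolvent.\<close>

lemma real_spectrum_cfc_subset:
  assumes "selfadjoint x" "continuous_on (real_spectrum x) h"
  shows "real_spectrum (cfc h x) \<subseteq> h ` real_spectrum x"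
proof
  fix t assume t: "t \<in> real_spectrum (cfc h x)"
  show "t \<in> h ` real_spectrum x"
  proof (rule ccontr)
    assume nt: "t \<notin> h ` real_spectrum x"
    let ?k = "\<lambda>s. 1 / (h s - t)"
    have c: "continuous_on (real_spectrum x) (\<lambda>s. h s - t)" "continuous_on (real_spectrum x) ?k"
      using nt by (auto intro!: continuous_intros assms)
    have "cfc (\<lambda>s. h s - t) x * cfc ?k x = cfc (\<lambda>s. 1) x"
      unfolding cfc_mult[OF assms(1) c, symmetric] using nt by (intro cfc_cong) auto
    moreover have "cfc (\<lambda>s. h s - t) x = cfc h x - t *\<^sub>R 1"
      by (simp add: cfc_diff assms cfc_const)
    ultimately have "cinvertible (cfc h x - t *\<^sub>R 1)"
      using cfc_commute[OF assms(1) c] by (intro cinvertibleI[of _ "cfc ?k x"]) (simp_all add: cfc_const assms)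
    with t show False by (simp add: mem_real_spectrum)
  qed
qed

text \<open>The rule is exact for polynomials \<open>k\<close>. Approximation is uniform on the
  image of \<open>h\<close>, which contains the spectrum of \<open>cfc h x\<close>.\<close>

lemma cfc_compose:
  assumes x: "selfadjoint x" and h: "continuous_on (real_spectrum x) h"
    and k: "continuous_on (h ` real_spectrum x) k"
  shows "cfc k (cfc h x) = cfc (\<lambda>t. k (h t)) x"
proof -
  let ?S = "h ` real_spectrum x"
  have sub: "real_spectrum (cfc h x) \<subseteq> ?S" by (rule real_spectrum_cfc_subset[OF x h])
  have "compact ?S" by (intro compact_continuous_image h compact_real_spectrum)
  then obtain ps where ps: "uniform_limit ?S (\<lambda>n t. poly (ps n) t) k sequentially"
    using uniform_approximation_by_poly k by blast
  have kh: "continuous_on (real_spectrum x) (\<lambda>t. k (h t))"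
    using continuous_on_compose2[OF k h] by simp
  have pe: "cfc (\<lambda>t. poly p (h t)) x = polyeval p (cfc h x)" for p
    by (induction p) (simp_all add: cfc_add cfc_mult cfc_const x h continuous_intros)
  show ?thesis
  proof (rule cfc_eqI[of _ _ ps])
    show "selfadjoint (cfc h x)" by (rule selfadjoint_cfc[OF x h])
    show "continuous_on (real_spectrum (cfc h x)) k" using k sub by (rule continuous_on_subset)
    show "uniform_limit (real_spectrum (cfc h x)) (\<lambda>n t. poly (ps n) t) k sequentially"
      using ps sub by (rule uniform_limit_on_subset)
    show "(\<lambda>n. polyeval (ps n) (cfc h x)) \<longlonglongrightarrow> cfc (\<lambda>t. k (h t)) x"
    proof (rule LIMSEQ_I)
      fix e :: real assume e: "e > 0"
      then obtain N where N: "\<forall>n\<ge>N. \<forall>s\<in>?S. \<bar>poly (ps n) s - k s\<bar> < e / 2"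
        using uniform_limitD[OF ps, of "e / 2"] by (auto simp: eventually_sequentially dist_real_def)
      have "norm (polyeval (ps n) (cfc h x) - cfc (\<lambda>t. k (h t)) x) \<le> e / 2" if "n \<ge> N" for n
      proof -
        have c: "continuous_on (real_spectrum x) (\<lambda>t. poly (ps n) (h t))" by (intro continuous_intros h)
        have "\<bar>poly (ps n) (h t) - k (h t)\<bar> \<le> e / 2" if "t \<in> real_spectrum x" for t
          using N \<open>n \<ge> N\<close> that by (simp add: less_imp_le)
        then show ?thesis unfolding pe[symmetric] cfc_diff[OF x c kh, symmetric]
          by (intro norm_cfc_le x continuous_on_diff c kh)
      qed
      with e show "\<exists>N. \<forall>n\<ge>N. norm (polyeval (ps n) (cfc h x) - cfc (\<lambda>t. k (h t)) x) < e"
        by (intro exI[of _ N]) fastforce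
    qed
  qed
qed

subsection \<open>Positive elements\<close>

lemma cpositiveI:
  assumes "selfadjoint x" "\<And>t. t \<in> real_spectrum x \<Longrightarrow> t \<ge> 0" shows "cpositive x"
  using assms by (auto simp: cpositive_def selfadjoint_cspectrum_eq)

lemma cpositiveD:
  assumes "cpositive x" shows "selfadjoint x" "t \<in> real_spectrum x \<Longrightarrow> t \<ge> 0"
  using assms by (auto simp: cpositive_def real_spectrum_def)

lemma real_spectrum_reflect: "t \<in> real_spectrum (r *\<^sub>R 1 - x) \<longleftrightarrow> r - t \<in> real_spectrum x"
proof -
  have "r *\<^sub>R 1 - x - t *\<^sub>R 1 = - (x - (r - t) *\<^sub>R 1)" by (simp add: algebra_simps)
  then show ?thesis by (simp only: mem_real_spectrum cinvertible_minus_iff)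
qed

text \<open>Together with \<open>cpositive_if_norm_le\<close>, this expresses positivity by a norm
  bound, so that sums and limits of positive elements reduce to norm estimates.\<close>

lemma cpositive_norm_le:
  assumes "cpositive x" "norm x \<le> r" shows "norm (r *\<^sub>R 1 - x) \<le> r"
proof -
  have "selfadjoint (r *\<^sub>R 1 - x)"
    by (intro selfadjoint_diff selfadjoint_scaleR selfadjoint_one cpositiveD[OF assms(1)])
  then obtain t where "t \<in> real_spectrum (r *\<^sub>R 1 - x)" "\<bar>t\<bar> = norm (r *\<^sub>R 1 - x)"
    by (rule selfadjoint_norm_attained)
  moreover from this(1) have "r - t \<in> real_spectrum x" by (simp add: real_spectrum_reflect)
  then have "0 \<le> r - t" "\<bar>r - t\<bar> \<le> norm x"
    using cpositiveD(2)[OF assms(1)] real_spectrum_norm_le by blast+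
  ultimately show ?thesis using assms(2) by linarith
qed

lemma cpositive_if_norm_le:
  assumes "selfadjoint x" "norm (r *\<^sub>R 1 - x) \<le> r" shows "cpositive x"
proof (rule cpositiveI[OF assms(1)])
  fix t assume "t \<in> real_spectrum x"
  then have "r - t \<in> real_spectrum (r *\<^sub>R 1 - x)" by (simp add: real_spectrum_reflect)
  with real_spectrum_norm_le assms(2) show "t \<ge> 0" by fastforce
qed

lemma cpositive_add:
  assumes "cpositive x" "cpositive y" shows "cpositive (x + y)"
proof (rule cpositive_if_norm_le[of _ "norm x + norm y"])
  have "(norm x + norm y) *\<^sub>R 1 - (x + y) = (norm x *\<^sub>R 1 - x) + (norm y *\<^sub>R 1 - y)"
    by (simp add: algebra_simps)
  then show "norm ((norm x + norm y) *\<^sub>R 1 - (x + y)) \<le> norm x + norm y"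
    using cpositive_norm_le[OF assms(1) order_refl] cpositive_norm_le[OF assms(2) order_refl]
    by (metis norm_triangle_mono)
qed (intro selfadjoint_add cpositiveD assms)

lemma cpositive_scaleR:
  assumes "cpositive x" "r \<ge> 0" shows "cpositive (r *\<^sub>R x)"
proof (rule cpositive_if_norm_le[of _ "r * norm x"])
  have "(r * norm x) *\<^sub>R 1 - r *\<^sub>R x = r *\<^sub>R (norm x *\<^sub>R 1 - x)" by (simp add: algebra_simps)
  then show "norm ((r * norm x) *\<^sub>R 1 - r *\<^sub>R x) \<le> r * norm x"
    using cpositive_norm_le[OF assms(1) order_refl] assms(2) by (simp add: mult_left_mono)
qed (intro selfadjoint_scaleR cpositiveD assms)

lemma cpositive_zero [simp]: "cpositive 0"
  by (rule cpositive_if_norm_le[of _ 0]) simp_all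

lemma cpositive_sum: "(\<And>i. i \<in> A \<Longrightarrow> cpositive (h i)) \<Longrightarrow> cpositive (sum h A)"
  by (induction A rule: infinite_finite_induct) (simp_all add: cpositive_add)

text \<open>A convergent sequence is bounded, so one radius \<open>K\<close> serves all its terms
  and the norm criterion passes to the limit.\<close>

lemma cpositive_limit:
  assumes "\<And>n. cpositive (X n)" "X \<longlonglongrightarrow> (b::'a::cstar_algebra)" shows "cpositive b"
proof -
  obtain K where K: "\<And>n. norm (X n) \<le> K"
    using convergent_imp_Bseq[of X] assms(2) by (auto simp: convergent_def Bseq_def)
  show ?thesis
  proof (rule cpositive_if_norm_le[of _ K])
    show "selfadjoint b" using selfadjoint_limit assms cpositiveD(1) by blast
    have "(\<lambda>n. norm (K *\<^sub>R 1 - X n)) \<longlonglongrightarrow> norm (K *\<^sub>R 1 - b)" by (intro tendsto_intros assms(2))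
    then show "norm (K *\<^sub>R 1 - b) \<le> K"
      by (rule tendsto_upperbound) (simp_all add: cpositive_norm_le assms(1) K)
  qed
qed

lemma cpositive_if_eventually_positive:
  assumes "\<And>n::nat. n > 0 \<Longrightarrow> cpositive (b + (1 / real n) *\<^sub>R (d::'a::cstar_algebra))" shows "cpositive b"
proof (rule cpositive_limit)
  show "cpositive (b + (1 / real (Suc n)) *\<^sub>R d)" for n by (rule assms) simp
  have "(\<lambda>n. b + (1 / real (Suc n)) *\<^sub>R d) \<longlonglongrightarrow> b + 0 *\<^sub>R d"
    by (intro tendsto_intros LIMSEQ_Suc[OF lim_1_over_n])
  then show "(\<lambda>n. b + (1 / real (Suc n)) *\<^sub>R d) \<longlonglongrightarrow> b" by simp
qed

lemma cpositive_cfc: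
  assumes "selfadjoint x" "continuous_on (real_spectrum x) h" "\<And>t. t \<in> real_spectrum x \<Longrightarrow> h t \<ge> 0"
  shows "cpositive (cfc h x)"
  using real_spectrum_cfc_subset[OF assms(1,2)] assms(3) by (intro cpositiveI selfadjoint_cfc assms) auto

lemma cpositive_square:
  assumes "selfadjoint (x::'a::cstar_algebra)" shows "cpositive (x * x)"
proof -
  have "cfc (\<lambda>t. t * t) x = x * x"
    using cfc_mult[OF assms, of "\<lambda>t. t" "\<lambda>t. t"] by (simp add: cfc_ident assms)
  moreover have "cpositive (cfc (\<lambda>t. t * t) x)" by (intro cpositive_cfc assms continuous_intros) simp
  ultimately show ?thesis by simp
qed

lemma cfc_sqrt_root:
  assumes "selfadjoint x" "continuous_on (real_spectrum x) h" "\<And>t. t \<in> real_spectrum x \<Longrightarrow> h t \<ge> 0"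
  shows "cfc (\<lambda>t. sqrt (h t)) x * cfc (\<lambda>t. sqrt (h t)) x = cfc h x"
proof -
  have c: "continuous_on (real_spectrum x) (\<lambda>t. sqrt (h t))" by (intro continuous_intros assms)
  show ?thesis unfolding cfc_mult[OF assms(1) c c, symmetric] by (rule cfc_cong) (simp add: assms(3))
qed

lemma cpositive_root:
  assumes "cpositive x" obtains y where "selfadjoint y" "y * y = x"
proof
  note x = cpositiveD[OF assms]
  show "selfadjoint (cfc sqrt x)" by (intro selfadjoint_cfc x continuous_intros)
  show "cfc sqrt x * cfc sqrt x = x"
    using cfc_sqrt_root[of x "\<lambda>t. t"] x by (simp add: cfc_ident)
qed

lemma cpositive_antisym:
  assumes "cpositive x" "cpositive (- x)" shows "x = 0"
proof -
  obtain t where t: "t \<in> real_spectrum x" "\<bar>t\<bar> = norm x"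
    using selfadjoint_norm_attained[OF cpositiveD(1)[OF assms(1)]] .
  then have "- t \<in> real_spectrum (- x)" using real_spectrum_reflect[of "- t" 0 x] by simp
  with t cpositiveD(2)[OF assms(1)] cpositiveD(2)[OF assms(2)] have "norm x = 0" by force
  then show ?thesis by simp
qed

section \<open>Positivity of \<open>adj y * y\<close>\<close>

text \<open>The spectra of the two products agree away from 0 by \<open>cinvertible_swap\<close>,
  and only a negative \<open>t\<close> has to be excluded.\<close>

lemma cpositive_minus_swap:
  assumes "cpositive (- (adj z * z))" shows "cpositive (- (z * adj (z::'a::cstar_algebra)))"
proof (rule cpositiveI)
  show "selfadjoint (- (z * adj z))" by (simp add: selfadjoint_def adj_minus adj_mult adj_adj)
  fix t assume t: "t \<in> real_spectrum (- (z * adj z))"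
  show "t \<ge> 0"
  proof (rule ccontr)
    assume neg: "\<not> t \<ge> 0"
    then have "cinvertible (- (adj z * z) - t *\<^sub>R 1)"
      using cpositiveD(2)[OF assms] by (auto simp: mem_real_spectrum)
    then have "cinvertible ((- 1 / t) *\<^sub>R (- (adj z * z) - t *\<^sub>R 1))" using neg by (intro cinvertible_scaleR) auto
    also have "(- 1 / t) *\<^sub>R (- (adj z * z) - t *\<^sub>R 1) = 1 - adj z * ((- 1 / t) *\<^sub>R z)"
      using neg by (simp add: algebra_simps)
    finally have "cinvertible (1 - (- 1 / t) *\<^sub>R z * adj z)" by (rule cinvertible_swap)
    then have "cinvertible ((- t) *\<^sub>R (1 - (- 1 / t) *\<^sub>R z * adj z))" using neg by (intro cinvertible_scaleR) auto
    also have "(- t) *\<^sub>R (1 - (- 1 / t) *\<^sub>R z * adj z) = - (z * adj z) - t *\<^sub>R 1"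
      using neg by (simp add: algebra_simps)
    finally show False using t by (simp add: mem_real_spectrum)
  qed
qed

text \<open>The sum of \<open>adj z * z\<close> and \<open>z * adj z\<close> is twice a sum of
  self-adjoint squares. If both summands are negative, \<open>adj z * z\<close> is positive as well,
  hence 0.\<close>

lemma adj_mult_self_not_negative:
  assumes "cpositive (- (adj z * z))" shows "z = (0::'a::cstar_algebra)"
proof -
  obtain h k where hk: "selfadjoint h" "selfadjoint k" "z = h + scaleC \<i> k" by (rule cartesian_decomposition)
  have "adj z * z + z * adj z = 2 *\<^sub>R (h * h + k * k)"
    unfolding hk(3) adj_cartesian[OF hk(1,2)] by (simp add: scaleC_algebra algebra_simps scaleR_2)
  moreover have "cpositive (2 *\<^sub>R (h * h + k * k))"
    by (intro cpositive_scaleR cpositive_add cpositive_square hk) simp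
  ultimately have "cpositive ((adj z * z + z * adj z) + - (z * adj z))"
    using cpositive_add cpositive_minus_swap[OF assms] by metis
  then have "adj z * z = 0" using cpositive_antisym assms by simp
  then have "(norm z)\<^sup>2 = 0" by (metis cstar_identity norm_zero)
  then show ?thesis by simp
qed

theorem cpositive_adj_mult: "cpositive (adj y * (y::'a::cstar_algebra))"
proof -
  let ?h = "adj y * y"
  let ?p = "\<lambda>t::real. max 0 t" and ?m = "\<lambda>t::real. max 0 (- t)"
  let ?n = "cfc ?m ?h"
  have sa: "selfadjoint ?h" by (rule selfadjoint_adj_mult)
  have cont: "continuous_on S ?p" "continuous_on S ?m" for S by (intro continuous_intros)+
  have san: "selfadjoint ?n" by (intro selfadjoint_cfc sa cont)
  have hn: "?h * ?n = - (?n * ?n)"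
  proof -
    have "?h * ?n = cfc (\<lambda>t. t * ?m t) ?h"
      using cfc_mult[OF sa continuous_on_id cont(2)] by (simp add: cfc_ident sa id_def)
    also have "\<dots> = cfc (\<lambda>t. (- 1) * (?m t * ?m t)) ?h" by (rule cfc_cong) (auto simp: max_def)
    also have "\<dots> = - (?n * ?n)"
      by (subst cfc_scaleR) (simp_all add: sa cfc_mult cont continuous_intros)
    finally show ?thesis .
  qed
  \<comment> \<open>Compressing by the negative part \<open>?n\<close> isolates the negative
    spectrum: \<open>adj ?z * ?z\<close> is minus the cube of \<open>?n\<close>, so the previous
    lemma kills \<open>?z\<close> and then \<open>?n\<close>.\<close>
  let ?z = "y * ?n"
  have "- (adj ?z * ?z) = ?n * (?n * ?n)"
    using hn by (simp add: adj_mult selfadjointD[OF san] mult.assoc)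
  also have "\<dots> = cfc (\<lambda>t. ?m t * (?m t * ?m t)) ?h"
    by (simp add: cfc_mult sa cont continuous_intros)
  also have "cpositive \<dots>" by (intro cpositive_cfc sa continuous_intros) auto
  finally have z: "?z = 0" by (rule adj_mult_self_not_negative)
  then have "?h * ?n = 0" by (simp add: mult.assoc)
  with hn have "norm (?n * ?n) = 0" by simp
  then have n0: "?n = 0" using norm_mult_self[OF san] by simp
  have "?h = cfc (\<lambda>t. ?p t - ?m t) ?h"
    using cfc_cong[of ?h "\<lambda>t. ?p t - ?m t" "\<lambda>t. t"] cfc_ident[OF sa] by (simp add: max_def)
  also have "\<dots> = cfc ?p ?h" by (simp only: cfc_diff[OF sa cont] n0) simp
  also have "cpositive \<dots>" by (intro cpositive_cfc sa cont) simp
  finally show ?thesis .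
qed

lemma cpositive_conjugate:
  assumes "cpositive r" shows "cpositive (adj w * r * (w::'a::cstar_algebra))"
proof -
  obtain y where y: "selfadjoint y" "y * y = r" using cpositive_root[OF assms] .
  have "adj (y * w) * (y * w) = adj w * r * w"
    by (simp add: adj_mult selfadjointD[OF y(1)] mult.assoc flip: y(2))
  then show ?thesis using cpositive_adj_mult[of "y * w"] by simp
qed

text \<open>The Bernstein basis, transported to an interval containing the spectrum, approximates
  the spectral resolution of \<open>x\<close> by squares; the second moment is off by \<open>O(1/n)\<close> only.\<close>

lemma approximate_spectral_resolution:
  fixes x :: "'a::cstar_algebra"
  assumes x: "selfadjoint x" and K: "norm x \<le> K" "K > 0" and n: "n > 0"
  obtains q :: "nat \<Rightarrow> 'a" and t :: "nat \<Rightarrow> real" where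
    "\<forall>i. selfadjoint (q i)"
    "(\<Sum>i\<le>n. q i * q i) = 1"
    "(\<Sum>i\<le>n. t i *\<^sub>R (q i * q i)) = x"
    "(\<Sum>i\<le>n. (t i)\<^sup>2 *\<^sub>R (q i * q i)) = x * x + (1 / real n) *\<^sub>R (K\<^sup>2 *\<^sub>R 1 - x * x)"
proof -
  \<comment> \<open>The affine map carries \<open>[-K, K]\<close> to \<open>[0, 1]\<close>;
    \<open>t i\<close> below is the preimage of the node \<open>i / n\<close>.\<close>
  define B where "B i s = Bernstein n i ((s + K) / (2 * K))" for i s
  define t where "t i = K * (2 * real i / real n - 1)" for i
  have cB: "continuous_on S (B i)" for S i
    unfolding B_def Bernstein_def using K by (intro continuous_intros) auto
  have B0: "B i s \<ge> 0" if "s \<in> real_spectrum x" for i s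
    unfolding B_def using real_spectrum_norm_le[OF that] K by (intro Bernstein_nonneg) (auto simp: field_simps)
  let ?q = "\<lambda>i. cfc (\<lambda>s. sqrt (B i s)) x"
  have qq: "?q i * ?q i = cfc (B i) x" for i by (rule cfc_sqrt_root[OF x cB B0])
  have m0: "(\<Sum>i\<le>n. B i s) = 1" for s by (simp add: B_def)
  have m1: "(\<Sum>i\<le>n. t i * B i s) = s" for s
  proof -
    have "(\<Sum>i\<le>n. t i * B i s) = (2 * K / n) * (\<Sum>i\<le>n. real i * B i s) - K * (\<Sum>i\<le>n. B i s)"
      by (simp add: t_def sum_distrib_left sum_subtractf algebra_simps)
    also have "\<dots> = s" using K n by (simp add: m0) (simp add: B_def field_simps)
    finally show ?thesis .
  qed
  \<comment> \<open>The excess over \<open>s * s\<close> is the binomial variance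
    \<open>4 K\<^sup>2 u (1 - u) / n\<close>, rewritten in \<open>s\<close>.\<close>
  have m2: "(\<Sum>i\<le>n. (t i)\<^sup>2 * B i s) = s * s + (1 / n) * (K\<^sup>2 - s * s)" for s
  proof -
    let ?u = "(s + K) / (2 * K)"
    have "(t i)\<^sup>2 = (4 * K\<^sup>2 / n\<^sup>2) * (real i * (real i - 1)) + (4 * K\<^sup>2 / n\<^sup>2 - 4 * K\<^sup>2 / n) * real i + K\<^sup>2" for i
      using n by (simp add: t_def power2_eq_square field_simps)
    then have "(\<Sum>i\<le>n. (t i)\<^sup>2 * B i s) = (4 * K\<^sup>2 / n\<^sup>2) * (\<Sum>i\<le>n. real i * (real i - 1) * B i s)
        + (4 * K\<^sup>2 / n\<^sup>2 - 4 * K\<^sup>2 / n) * (\<Sum>i\<le>n. real i * B i s) + K\<^sup>2 * (\<Sum>i\<le>n. B i s)"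
      by (simp only: sum_distrib_left sum.distrib[symmetric]) (simp add: algebra_simps)
    also have "\<dots> = (4 * K\<^sup>2 / n\<^sup>2) * (n * (real n - 1) * ?u\<^sup>2) + (4 * K\<^sup>2 / n\<^sup>2 - 4 * K\<^sup>2 / n) * (n * ?u) + K\<^sup>2"
      by (simp only: B_def sum_kk_Bernstein sum_k_Bernstein sum_Bernstein)
    also have "\<dots> = s * s + (1 / n) * (K\<^sup>2 - s * s)"
      using n K by (simp add: power2_eq_square divide_simps) (simp add: algebra_simps)
    finally show ?thesis .
  qed
  have S: "(\<Sum>i\<le>n. a i *\<^sub>R (?q i * ?q i)) = cfc (\<lambda>s. \<Sum>i\<le>n. a i * B i s) x" for a :: "nat \<Rightarrow> real"
    by (simp add: qq cfc_sum cfc_scaleR x cB continuous_intros)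
  have sq: "cfc (\<lambda>s. s * s) x = x * x"
    using cfc_mult[OF x continuous_on_id continuous_on_id] by (simp add: cfc_ident x id_def)
  show thesis
  proof (rule that[of ?q t])
    show "\<forall>i. selfadjoint (?q i)" by (intro allI selfadjoint_cfc x continuous_intros cB)
    show "(\<Sum>i\<le>n. ?q i * ?q i) = 1" using S[of "\<lambda>_. 1"] by (simp add: m0 cfc_const x)
    show "(\<Sum>i\<le>n. t i *\<^sub>R (?q i * ?q i)) = x" unfolding S by (simp add: m1 cfc_ident x)
    show "(\<Sum>i\<le>n. (t i)\<^sup>2 *\<^sub>R (?q i * ?q i)) = x * x + (1 / real n) *\<^sub>R (K\<^sup>2 *\<^sub>R 1 - x * x)"
    proof -
      have c: "continuous_on (real_spectrum x) (\<lambda>s. s * s)"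
        "continuous_on (real_spectrum x) (\<lambda>s. K\<^sup>2 - s * s)" by (intro continuous_intros)+
      have "cfc (\<lambda>s. K\<^sup>2 - s * s) x = K\<^sup>2 *\<^sub>R 1 - x * x"
        by (simp add: cfc_diff cfc_const x c sq)
      then show ?thesis
        unfolding S m2 cfc_add[OF x c(1) continuous_on_mult[OF continuous_on_const c(2)]]
        by (simp only: cfc_scaleR[OF x c(2)] sq)
    qed
  qed
qed

subsection \<open>Tracial positive maps\<close>

locale tracial_positive_map =
  fixes \<Phi> :: "'a::cstar_algebra \<Rightarrow> 'b::cstar_algebra"
  assumes clinear: "clinear_map \<Phi>"
    and positive: "positive_map \<Phi>"
    and is_tracial: "tracial \<Phi>"
begin

lemma map_add: "\<Phi> (x + y) = \<Phi> x + \<Phi> y"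
  and map_scaleC: "\<Phi> (scaleC c x) = scaleC c (\<Phi> x)"
  using clinear by (simp_all add: clinear_map_def)

lemma map_scaleR: "\<Phi> (r *\<^sub>R x) = r *\<^sub>R \<Phi> x"
  using map_scaleC[of "complex_of_real r" x] by (simp add: scaleC_scaleR)

lemma map_zero [simp]: "\<Phi> 0 = 0"
  using map_scaleR[of 0 0] by simp

lemma map_diff: "\<Phi> (x - y) = \<Phi> x - \<Phi> y"
  using map_add[of x "(- 1) *\<^sub>R y"] by (simp only: map_scaleR) simp

lemma map_sum: "\<Phi> (sum h A) = (\<Sum>i\<in>A. \<Phi> (h i))"
  by (induction A rule: infinite_finite_induct) (simp_all add: map_add)

lemma map_commute: "\<Phi> (x * y) = \<Phi> (y * x)"
  using is_tracial by (simp add: tracial_def)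

lemma map_cpositive: "cpositive x \<Longrightarrow> cpositive (\<Phi> x)"
  using positive by (simp add: positive_map_def)

text \<open>\<open>x\<close> is the difference of the positive elements
  \<open>norm x *\<^sub>R 1\<close> and \<open>norm x *\<^sub>R 1 - x\<close>.\<close>

lemma map_selfadjoint:
  assumes "selfadjoint x" shows "selfadjoint (\<Phi> x)"
proof -
  have "cpositive (norm x *\<^sub>R 1 - x)"
  proof (rule cpositiveI)
    show "selfadjoint (norm x *\<^sub>R 1 - x)" by (intro selfadjoint_diff selfadjoint_scaleR selfadjoint_one assms)
    show "t \<ge> 0" if "t \<in> real_spectrum (norm x *\<^sub>R 1 - x)" for t
      using real_spectrum_norm_le[of "norm x - t" x] that by (simp add: real_spectrum_reflect)
  qed
  moreover have "cpositive (norm x *\<^sub>R (1::'a))"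
    using cpositive_scaleR[OF cpositive_square[OF selfadjoint_one], of "norm x"] by simp
  ultimately have "selfadjoint (\<Phi> (norm x *\<^sub>R 1) - \<Phi> (norm x *\<^sub>R 1 - x))"
    by (intro selfadjoint_diff cpositiveD map_cpositive)
  then show ?thesis by (simp flip: map_diff)
qed

lemma map_adj: "\<Phi> (adj x) = adj (\<Phi> x)"
proof -
  obtain h k where "selfadjoint h" "selfadjoint k" "x = h + scaleC \<i> k" by (rule cartesian_decomposition)
  then show ?thesis
    by (simp add: adj_cartesian map_add map_diff map_scaleC map_selfadjoint)
qed

text \<open>Under \<open>\<Phi>\<close> the two outer factors \<open>q j\<close> merge by
  traciality; this yields the marginal in which \<open>h\<close> has been summed out.\<close>

lemma map_sum_conjugate:
  "\<Phi> (\<Sum>j\<in>J. b j *\<^sub>R (q j * y * q j)) = \<Phi> ((\<Sum>j\<in>J. b j *\<^sub>R (q j * q j)) * y)"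
proof -
  have "\<Phi> (q j * y * q j) = \<Phi> (q j * q j * y)" for j
    using map_commute[of "q j * y" "q j"] by (simp add: mult.assoc)
  then show ?thesis by (simp add: map_sum map_scaleR sum_distrib_right)
qed

text \<open>For three self-adjoint elements, \<open>\<Phi>\<close> is not a positive functional of commuting variables,
  but by traciality \<open>(\<alpha>, \<beta>, \<gamma>) \<mapsto> \<Phi> (\<alpha>(h) \<beta>(c)\<^sup>\<onehalf> \<gamma>(k) \<beta>(c)\<^sup>\<onehalf>)\<close> behaves like a positive joint
  distribution in which \<open>h\<close> and \<open>k\<close> are independent given \<open>c\<close>. Its \<open>(h, c)\<close>- and \<open>(c, k)\<close>-marginals
  are those of \<open>\<Phi>\<close>, and the quadratic form below involves no other moments.\<close>

lemma cpositive_quadratic_form: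
  assumes sa: "selfadjoint h" "selfadjoint k" "selfadjoint c"
  shows "cpositive (\<Phi> (h * h) + \<Phi> (k * k) + adj w * \<Phi> (c * c) * w
    - (\<Phi> (c * h) * w + adj w * \<Phi> (c * h)) + scaleC \<i> (\<Phi> (c * k) * w - adj w * \<Phi> (c * k)))"
proof -
  \<comment> \<open>A common bound for all three elements; \<open>+ 1\<close> keeps it positive when
    they vanish.\<close>
  define K where "K = norm h + norm k + norm c + 1"
  have K: "norm h \<le> K" "norm k \<le> K" "norm c \<le> K" "K > 0"
    by (auto simp: K_def intro!: add_nonneg_pos)
  let ?C = "\<lambda>x. K\<^sup>2 *\<^sub>R 1 - x * x"
  let ?Z = "\<Phi> (h * h) + \<Phi> (k * k) + adj w * \<Phi> (c * c) * w
    - (\<Phi> (c * h) * w + adj w * \<Phi> (c * h)) + scaleC \<i> (\<Phi> (c * k) * w - adj w * \<Phi> (c * k))"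
  \<comment> \<open>Collects the excesses of the three discretised second moments, each scaled by
    \<open>1 / n\<close>.\<close>
  let ?D = "\<Phi> (?C h) + \<Phi> (?C k) + adj w * \<Phi> (?C c) * w"
  show ?thesis
  proof (rule cpositive_if_eventually_positive)
    fix n :: nat assume n: "n > 0"
    obtain p a where p: "\<forall>i. selfadjoint (p i)" "(\<Sum>i\<le>n. p i * p i) = 1"
      "(\<Sum>i\<le>n. a i *\<^sub>R (p i * p i)) = h"
      "(\<Sum>i\<le>n. (a i)\<^sup>2 *\<^sub>R (p i * p i)) = h * h + (1 / real n) *\<^sub>R ?C h"
      by (rule approximate_spectral_resolution[OF sa(1) K(1,4) n])
    obtain q b where q: "\<forall>i. selfadjoint (q i)" "(\<Sum>i\<le>n. q i * q i) = 1"
      "(\<Sum>i\<le>n. b i *\<^sub>R (q i * q i)) = c"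
      "(\<Sum>i\<le>n. (b i)\<^sup>2 *\<^sub>R (q i * q i)) = c * c + (1 / real n) *\<^sub>R ?C c"
      by (rule approximate_spectral_resolution[OF sa(3) K(3,4) n])
    obtain s d where s: "\<forall>i. selfadjoint (s i)" "(\<Sum>i\<le>n. s i * s i) = 1"
      "(\<Sum>i\<le>n. d i *\<^sub>R (s i * s i)) = k"
      "(\<Sum>i\<le>n. (d i)\<^sup>2 *\<^sub>R (s i * s i)) = k * k + (1 / real n) *\<^sub>R ?C k"
      by (rule approximate_spectral_resolution[OF sa(2) K(2,4) n])
    define r where "r i j l = \<Phi> (p i * p i * (q j * (s l * s l) * q j))" for i j l
    have r_pos: "cpositive (r i j l)" for i j l
    proof -
      \<comment> \<open>Moving one \<open>p i\<close> cyclically to the end makes the argument of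
        \<open>\<Phi>\<close> symmetric.\<close>
      let ?z = "s l * q j * p i"
      have "r i j l = \<Phi> (adj ?z * ?z)"
        unfolding r_def using map_commute[of "p i" "p i * (q j * (s l * s l) * q j)"]
        by (simp add: adj_mult selfadjointD[OF p(1)[rule_format]] selfadjointD[OF q(1)[rule_format]] selfadjointD[OF s(1)[rule_format]] mult.assoc)
      then show ?thesis using map_cpositive[OF cpositive_adj_mult] by simp
    qed
    define M where "M \<alpha> \<beta> \<gamma> = (\<Sum>i\<le>n. \<Sum>j\<le>n. \<Sum>l\<le>n. (\<alpha> i * \<beta> j * \<gamma> l) *\<^sub>R r i j l)" for \<alpha> \<beta> \<gamma>
    have M: "M \<alpha> \<beta> \<gamma> = \<Phi> ((\<Sum>i\<le>n. \<alpha> i *\<^sub>R (p i * p i)) *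
        (\<Sum>j\<le>n. \<beta> j *\<^sub>R (q j * (\<Sum>l\<le>n. \<gamma> l *\<^sub>R (s l * s l)) * q j)))" for \<alpha> \<beta> \<gamma>
      unfolding M_def r_def sum_product
      by (simp add: map_sum map_scaleR sum_distrib_left sum_distrib_right scaleR_sum_right ac_simps)
    let ?one = "\<lambda>_::nat. 1::real"
    \<comment> \<open>Summing out \<open>i\<close> needs traciality to join the two
      \<open>q j\<close>; summing out \<open>l\<close> in \<open>M3\<close> joins them
      directly.\<close>
    have M1: "M ?one \<beta> \<gamma> = \<Phi> ((\<Sum>j\<le>n. \<beta> j *\<^sub>R (q j * q j)) * (\<Sum>l\<le>n. \<gamma> l *\<^sub>R (s l * s l)))" for \<beta> \<gamma>
      unfolding M by (simp add: p(2) map_sum_conjugate)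
    have M3: "M \<alpha> \<beta> ?one = \<Phi> ((\<Sum>i\<le>n. \<alpha> i *\<^sub>R (p i * p i)) * (\<Sum>j\<le>n. \<beta> j *\<^sub>R (q j * q j)))" for \<alpha> \<beta>
      unfolding M by (simp add: s(2))
    have moments:
      "M (\<lambda>i. (a i)\<^sup>2) ?one ?one = \<Phi> (h * h) + (1 / real n) *\<^sub>R \<Phi> (?C h)"
      "M ?one ?one (\<lambda>l. (d l)\<^sup>2) = \<Phi> (k * k) + (1 / real n) *\<^sub>R \<Phi> (?C k)"
      "M ?one (\<lambda>j. (b j)\<^sup>2) ?one = \<Phi> (c * c) + (1 / real n) *\<^sub>R \<Phi> (?C c)"
      "M a b ?one = \<Phi> (c * h)" "M ?one b d = \<Phi> (c * k)"
      by (simp_all only: M3 M1 p q s map_add map_scaleR map_commute[of h c] scaleR_one mult_1_left mult_1_right)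
    \<comment> \<open>The discrete form of \<open>x - c w\<close> with \<open>x = h + i k\<close>.
      As scalars commute with \<open>r i j l\<close>, the cross terms in \<open>a i * d l\<close>
      cancel, and no joint moment of \<open>h\<close> and \<open>k\<close> arises.\<close>
    define v where "v i j l = a i *\<^sub>R 1 + scaleC \<i> (d l *\<^sub>R 1) - b j *\<^sub>R w" for i j l
    have "adj (v i j l) * r i j l * v i j l
        = ((a i)\<^sup>2 * 1 * 1) *\<^sub>R r i j l + (1 * 1 * (d l)\<^sup>2) *\<^sub>R r i j l
        + adj w * ((1 * (b j)\<^sup>2 * 1) *\<^sub>R r i j l) * w
        - (((a i * b j * 1) *\<^sub>R r i j l) * w + adj w * ((a i * b j * 1) *\<^sub>R r i j l))
        + scaleC \<i> (((1 * b j * d l) *\<^sub>R r i j l) * w - adj w * ((1 * b j * d l) *\<^sub>R r i j l))" for i j l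
      unfolding v_def by (simp add: scaleC_algebra power2_eq_square algebra_simps)
    then have "(\<Sum>i\<le>n. \<Sum>j\<le>n. \<Sum>l\<le>n. adj (v i j l) * r i j l * v i j l)
        = M (\<lambda>i. (a i)\<^sup>2) ?one ?one + M ?one ?one (\<lambda>l. (d l)\<^sup>2) + adj w * M ?one (\<lambda>j. (b j)\<^sup>2) ?one * w
        - (M a b ?one * w + adj w * M a b ?one) + scaleC \<i> (M ?one b d * w - adj w * M ?one b d)"
      unfolding M_def
      by (simp only: sum.distrib sum_subtractf sum_distrib_left sum_distrib_right scaleC_sum_right
          scaleC_diff_right)
    also have "\<dots> = ?Z + (1 / real n) *\<^sub>R ?D"
      unfolding moments by (simp add: algebra_simps)
    finally show "cpositive (?Z + (1 / real n) *\<^sub>R ?D)"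
      using r_pos by (metis (no_types, lifting) cpositive_sum cpositive_conjugate)
  qed
qed

text \<open>The quadratic form is evaluated at the \<open>w\<close> that completes the square; what
  remains is the difference of the two sides.\<close>

proposition map_Schwarz:
  assumes c: "selfadjoint c" and inv: "cinvertible (\<Phi> (c * c))"
  shows "cle (\<Phi> (adj x * c) * cinv (\<Phi> (c * c)) * \<Phi> (c * x)) (\<Phi> (adj x * x))"
proof -
  obtain h k where hk: "selfadjoint h" "selfadjoint k" and x: "x = h + scaleC \<i> k"
    by (rule cartesian_decomposition)
  let ?Q = "\<Phi> (c * c)"
  have saQ: "adj (cinv ?Q) = cinv ?Q"
    using cinv_selfadjoint[OF inv] map_selfadjoint[OF selfadjoint_mult[OF c c]] by (simp add: selfadjointD)
  define w where "w = cinv ?Q * \<Phi> (c * x)"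
  have cx: "\<Phi> (c * x) = \<Phi> (c * h) + scaleC \<i> (\<Phi> (c * k))"
    by (simp add: x distrib_left mult_scaleC_right map_add map_scaleC)
  have xc: "\<Phi> (adj x * c) = \<Phi> (c * h) - scaleC \<i> (\<Phi> (c * k))"
    unfolding x adj_cartesian[OF hk]
    by (simp add: left_diff_distrib mult_scaleC_left map_diff map_scaleC map_commute[of _ c])
  \<comment> \<open>Traciality removes the commutator of \<open>h\<close> and
    \<open>k\<close>.\<close>
  have xx: "\<Phi> (adj x * x) = \<Phi> (h * h) + \<Phi> (k * k)"
    unfolding x adj_cartesian[OF hk]
    by (simp add: scaleC_algebra algebra_simps map_add map_diff map_scaleC map_commute[of h k])
  have "adj (\<Phi> (c * x)) = \<Phi> (adj x * c)" using c by (simp add: adj_mult selfadjointD flip: map_adj)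
  then have aw: "adj w = \<Phi> (adj x * c) * cinv ?Q" by (simp add: w_def adj_mult saQ)
  have "adj w * ?Q * w = \<Phi> (adj x * c) * w"
    unfolding aw using cinv_mult(2)[OF inv] by (simp add: mult.assoc)
  moreover have "\<Phi> (adj x * c) * w = \<Phi> (c * h) * w - scaleC \<i> (\<Phi> (c * k) * w)"
    by (simp add: xc left_diff_distrib mult_scaleC_left)
  moreover have "adj w * \<Phi> (c * x) = adj w * \<Phi> (c * h) + scaleC \<i> (adj w * \<Phi> (c * k))"
    by (simp add: cx distrib_left mult_scaleC_right)
  ultimately have "\<Phi> (h * h) + \<Phi> (k * k) + adj w * ?Q * w
    - (\<Phi> (c * h) * w + adj w * \<Phi> (c * h)) + scaleC \<i> (\<Phi> (c * k) * w - adj w * \<Phi> (c * k))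
    = \<Phi> (adj x * x) - adj w * \<Phi> (c * x)"
    by (simp add: xx scaleC_diff_right algebra_simps)
  then show ?thesis
    using cpositive_quadratic_form[OF hk c, of w] by (simp add: cle_def aw)
qed

text \<open>\<open>u\<close> and \<open>v\<close> play the roles of the square roots of
  \<open>f\<close> and \<open>g\<close> at \<open>\<rho>\<close>. The cross terms of
  \<open>adj ?z * ?z\<close> have the same image under \<open>\<Phi>\<close> because
  \<open>u\<close> and \<open>v\<close> commute.\<close>

lemma map_arithmetic_geometric:
  assumes u: "selfadjoint u" and v: "selfadjoint v" and uv: "u * v = v * u"
  shows "cle (\<Phi> (u * v * adj x * (u * v) * x))
    ((1/2) *\<^sub>R (\<Phi> (u * u * adj x * (v * v) * x) + \<Phi> (u * u * x * (v * v) * adj x)))"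
proof -
  let ?z = "v * x * u - u * x * v"
  have vul: "v * (u * y) = u * (v * y)" for y by (metis uv mult.assoc)
  have adjz: "adj ?z = u * adj x * v - v * adj x * u"
    using u v by (simp add: adj_diff adj_mult selfadjointD mult.assoc)
  have "\<Phi> ((u * adj x * v) * (v * x * u)) = \<Phi> (u * u * adj x * (v * v) * x)"
    using map_commute[of "u * adj x * v * v * x" u] by (simp add: mult.assoc)
  moreover have "\<Phi> ((v * adj x * u) * (u * x * v)) = \<Phi> (u * u * x * (v * v) * adj x)"
    using map_commute[of "v * adj x" "u * u * x * v"] by (simp add: mult.assoc)
  moreover have "\<Phi> ((u * adj x * v) * (u * x * v)) = \<Phi> (u * v * adj x * (u * v) * x)"
    using map_commute[of "u * adj x * v * u * x" v] by (simp add: vul mult.assoc)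
  moreover have "\<Phi> ((v * adj x * u) * (v * x * u)) = \<Phi> (u * v * adj x * (u * v) * x)"
    using map_commute[of "v * adj x * u * v * x" u] by (simp add: mult.assoc)
  ultimately have "\<Phi> (adj ?z * ?z) = \<Phi> (u * u * adj x * (v * v) * x) + \<Phi> (u * u * x * (v * v) * adj x)
      - 2 *\<^sub>R \<Phi> (u * v * adj x * (u * v) * x)"
    unfolding adjz left_diff_distrib right_diff_distrib map_diff by (simp add: scaleR_2)
  moreover have "cpositive ((1/2) *\<^sub>R \<Phi> (adj ?z * ?z))"
    by (intro cpositive_scaleR map_cpositive cpositive_adj_mult) simp
  ultimately show ?thesis by (simp add: cle_def scaleR_diff_right)
qed

end

text \<open>Both chains rest on a lower and an upper bound for
  \<open>\<Phi> (c * adj A * c * A)\<close>, where \<open>c\<close> is the square root of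
  \<open>f g\<close> at \<open>\<rho>\<close>. Subtracting from
  \<open>\<Phi> (F * G * A * A)\<close> turns the first chain into the second.\<close>

theorem theorem5p1:
  fixes \<Phi> :: "'a::cstar_algebra \<Rightarrow> 'b::cstar_algebra"
    and \<rho> :: 'a
    and f g :: "real \<Rightarrow> real"
    and I :: "real set"
  assumes lin: "clinear_map \<Phi>"
    and pos: "positive_map \<Phi>"
    and tr: "tracial \<Phi>"
    and sa: "selfadjoint \<rho>"
    and I_int: "is_interval I"
    and I_spec: "real_spectrum \<rho> \<subseteq> I"
    and f_cont: "continuous_on I f" and g_cont: "continuous_on I g"
    and f_pos: "\<forall>t\<in>I. f t \<ge> 0" and g_pos: "\<forall>t\<in>I. g t \<ge> 0"
    and fg_pos: "cstrictly_positive (cfc f \<rho> * cfc g \<rho>)"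
    and Phi_inv: "cinvertible (\<Phi> (cfc f \<rho> * cfc g \<rho>))"
  shows "(\<forall>A. cle (\<Phi> (cfc sqrt (cfc f \<rho>) * cfc sqrt (cfc g \<rho>) * adj A
                         * cfc sqrt (cfc f \<rho>) * cfc sqrt (cfc g \<rho>) * A))
                (scaleR (1/2) (\<Phi> (cfc f \<rho> * adj A * cfc g \<rho> * A)
                               + \<Phi> (cfc f \<rho> * A * cfc g \<rho> * adj A)))
           \<and> cle (\<Phi> (cfc f \<rho> * adj A * cfc g \<rho>) * cinv (\<Phi> (cfc f \<rho> * cfc g \<rho>))
                  * \<Phi> (cfc g \<rho> * A * cfc f \<rho>))
                (\<Phi> (cfc sqrt (cfc f \<rho>) * cfc sqrt (cfc g \<rho>) * adj A
                    * cfc sqrt (cfc f \<rho>) * cfc sqrt (cfc g \<rho>) * A)))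
       \<and> (\<forall>A. selfadjoint A \<longrightarrow>
            cle (Info \<rho> \<Phi> f g A) (Info \<rho> \<Phi> (\<lambda>t. sqrt (f t * g t)) (\<lambda>t. sqrt (f t * g t)) A)
            \<and> cle (Info \<rho> \<Phi> (\<lambda>t. sqrt (f t * g t)) (\<lambda>t. sqrt (f t * g t)) A)
                  (Var \<rho> \<Phi> (\<lambda>t. f t * g t) (\<lambda>_. 1) A))"
proof -
  interpret tracial_positive_map \<Phi> using lin pos tr by unfold_locales
  let ?S = "real_spectrum \<rho>"
  have cont: "continuous_on ?S f" "continuous_on ?S g"
    using f_cont g_cont I_spec continuous_on_subset by blast+
  have nonneg: "f t \<ge> 0" "g t \<ge> 0" if "t \<in> ?S" for t using f_pos g_pos I_spec that by blast+
  define F where "F = cfc f \<rho>"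
  define G where "G = cfc g \<rho>"
  define u where "u = cfc sqrt F"
  define v where "v = cfc sqrt G"
  define c where "c = cfc (\<lambda>t. sqrt (f t * g t)) \<rho>"
  define d where "d = cfc (\<lambda>t. sqrt (sqrt (f t * g t))) \<rho>"
  \<comment> \<open>The statement takes roots of \<open>cfc f \<rho>\<close> and
    \<open>cfc g \<rho>\<close>; composition turns them into functions of \<open>\<rho>\<close>,
    which multiply pointwise.\<close>
  have u_eq: "u = cfc (\<lambda>t. sqrt (f t)) \<rho>" and v_eq: "v = cfc (\<lambda>t. sqrt (g t)) \<rho>"
    unfolding u_def v_def F_def G_def by (intro cfc_compose sa cont continuous_intros)+
  have self: "selfadjoint u" "selfadjoint v" "selfadjoint c" "selfadjoint d"
    unfolding u_eq v_eq c_def d_def by (intro selfadjoint_cfc sa continuous_intros cont)+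
  have uu: "u * u = F" and vv: "v * v = G"
    unfolding u_eq v_eq F_def G_def using nonneg by (auto intro!: cfc_sqrt_root sa cont)
  have uv: "u * v = c" and vu: "v * u = c"
    unfolding u_eq v_eq c_def
    by (subst cfc_mult[symmetric]; simp add: sa cont continuous_intros real_sqrt_mult mult.commute)+
  have fg: "cfc (\<lambda>t. f t * g t) \<rho> = F * G" unfolding F_def G_def by (intro cfc_mult sa cont)
  have FG: "F * G = G * F" unfolding F_def G_def by (intro cfc_commute sa cont)
  have cc: "c * c = F * G"
    unfolding c_def fg[symmetric] by (intro cfc_sqrt_root sa continuous_intros cont mult_nonneg_nonneg nonneg)
  have dd: "d * d = c"
    unfolding d_def c_def by (intro cfc_sqrt_root sa continuous_intros cont real_sqrt_ge_zero mult_nonneg_nonneg nonneg)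
  have first: "cle (\<Phi> (c * adj A * c * A)) ((1/2) *\<^sub>R (\<Phi> (F * adj A * G * A) + \<Phi> (F * A * G * adj A)))" for A
    using map_arithmetic_geometric[OF self(1,2), of A] by (simp add: uv vu uu vv)
  have second: "cle (\<Phi> (F * G * adj A) * cinv (\<Phi> (F * G)) * \<Phi> (F * G * A)) (\<Phi> (c * adj A * c * A))" for A
  proof -
    \<comment> \<open>Splitting \<open>c\<close> as \<open>d * d\<close> around \<open>A\<close>
      gives the middle term as \<open>\<Phi> (adj ?x * ?x)\<close>, while
      \<open>\<Phi> (c * ?x)\<close> collapses cyclically to
      \<open>\<Phi> (c * c * A)\<close>.\<close>
    let ?x = "d * A * d"
    have adjx: "adj ?x = d * adj A * d" using self(4) by (simp add: adj_mult selfadjointD mult.assoc)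
    have "\<Phi> (adj ?x * ?x) = \<Phi> (c * adj A * c * A)"
      unfolding adjx using map_commute[of "d * adj A * d * d * A" d] by (simp add: mult.assoc flip: dd)
    moreover have "\<Phi> (c * ?x) = \<Phi> (F * G * A)"
      using map_commute[of "c * d * A" d] by (simp add: mult.assoc flip: cc dd)
    moreover have "\<Phi> (adj ?x * c) = \<Phi> (F * G * adj A)"
      unfolding adjx map_commute[of _ c] using map_commute[of "c * d * adj A" d]
      by (simp add: mult.assoc flip: cc dd)
    ultimately show ?thesis
      using map_Schwarz[OF self(3), of ?x] Phi_inv by (simp add: cc F_def[symmetric] G_def[symmetric])
  qed
  have sq: "\<Phi> (u * v * adj A * u * v * A) = \<Phi> (c * adj A * c * A)" for A
    by (simp add: mult.assoc flip: uv)
  have tr1: "\<Phi> (F * adj A * G) = \<Phi> (F * G * adj A)" and tr2: "\<Phi> (G * A * F) = \<Phi> (F * G * A)" for A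
    using map_commute[of "F * adj A" G] map_commute[of "G * A" F] by (simp_all add: FG flip: mult.assoc)
  have part1: "cle (\<Phi> (u * v * adj A * u * v * A)) ((1/2) *\<^sub>R (\<Phi> (F * adj A * G * A) + \<Phi> (F * A * G * adj A)))
      \<and> cle (\<Phi> (F * adj A * G) * cinv (\<Phi> (F * G)) * \<Phi> (G * A * F)) (\<Phi> (u * v * adj A * u * v * A))" for A
    unfolding sq tr1 tr2 using first second by blast
  have part2: "cle (Info \<rho> \<Phi> f g A) (Info \<rho> \<Phi> (\<lambda>t. sqrt (f t * g t)) (\<lambda>t. sqrt (f t * g t)) A)
      \<and> cle (Info \<rho> \<Phi> (\<lambda>t. sqrt (f t * g t)) (\<lambda>t. sqrt (f t * g t)) A)
            (Var \<rho> \<Phi> (\<lambda>t. f t * g t) (\<lambda>_. 1) A)" if A: "selfadjoint A" for A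
  proof -
    \<comment> \<open>All three quantities share the first term, so the inequalities reverse; for
      self-adjoint \<open>A\<close> the two terms of the arithmetic mean coincide.\<close>
    have "Info \<rho> \<Phi> f g A = \<Phi> (F * G * A * A) - \<Phi> (F * A * G * A)"
      "Info \<rho> \<Phi> (\<lambda>t. sqrt (f t * g t)) (\<lambda>t. sqrt (f t * g t)) A = \<Phi> (F * G * A * A) - \<Phi> (c * A * c * A)"
      "Var \<rho> \<Phi> (\<lambda>t. f t * g t) (\<lambda>_. 1) A
        = \<Phi> (F * G * A * A) - \<Phi> (F * G * A) * cinv (\<Phi> (F * G)) * \<Phi> (F * G * A)"
      unfolding Info_def Corr_def Var_def Cov_def selfadjointD[OF A] fg c_def[symmetric] cc
      by (simp_all add: F_def G_def cfc_const sa)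
    then show ?thesis
      using first[of A] second[of A] by (simp add: cle_def selfadjointD[OF A] flip: scaleR_2)
  qed
  from part1 part2 show ?thesis unfolding u_def v_def F_def G_def by blast
qed

end
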